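(* Let $K$ be a field, let $\mathcal{A}$ be the variety of associative $K$-algebras with (or without) $1$, and let $\mathcal{A}^\circ$ be the category of finitely generated free algebras of $\mathcal{A}$. Then the group $\mathrm{Aut}\,\mathcal{A}^\circ$ of automorphisms of the category $\mathcal{A}^\circ$ is generated by the semi-inner and the mirror automorphisms of the category $\mathcal{A}^\circ$.
   Context: Either one works throughout with associative algebras with $1$ (and homomorphisms preserve $1$), or throughout with associative algebras not required to have $1$; the claim is made for each of these two varieties. Fix an infinite set $X^0$. The category $\mathcal{A}^\circ$ has as objects the free associative $K$-algebras $A(X)$ of $\mathcal{A}$ on finite subsets $X\subset X^0$, and as morphisms all $K$-algebra homomorphisms between them. An automorphism of a category is a functor from the category to itself that is bijective on objects and on morphisms; automorphisms form a group under composition. Semi-inner automorphisms: for algebras $A_1,A_2\in\mathcal{A}$, a semi-isomorphism $(\delta,s):A_1\to A_2$ consists of a field automorphism $\delta\in\mathrm{Aut}\,K$ and a ring isomorphism $s:A_1\to A_2$ such that $s(\alpha u)=\delta(\alpha)s(u)$ for all $\alpha\in K$, $u\in A_1$. An automorphism $\varphi\in\mathrm{Aut}\,\mathcal{A}^\circ$ is called semi-inner if there are $\delta\in\mathrm{Aut}\,K$ and a family of semi-isomorphisms $(\delta,s_{A(X)}):A(X)\to\varphi(A(X))$, one for each object $A(X)$ and all with the same $\delta$, such that $\varphi(\nu)\circ s_{A(X)}=s_{A(Y)}\circ\nu$ for every homomorphism $\nu:A(X)\to A(Y)$. Mirror automorphisms: for a finite set $Y\subset X^0$, let $\delta_Y:A(Y)\to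 A(Y)$ be the $K$-linear anti-automorphism of $A(Y)$ fixing every element of $Y$, i.e. reversing every word: $\delta_Y(y_1y_2\cdots y_m)=y_m\cdots y_2y_1$ for $y_i\in Y$. An automorphism $\varphi\in\mathrm{Aut}\,\mathcal{A}^\circ$ is called mirror if it fixes all objects and, for every $\nu:A(X)\to A(Y)$, $\varphi(\nu):A(X)\to A(Y)$ is the homomorphism with $\varphi(\nu)(x)=\delta_Y(\nu(x))$ for all $x\in X$. *)

theory Defs
  imports "HOL-Library.Poly_Mapping" "HOL-Algebra.Generated_Groups"
begin

section \<open>Categories and their automorphism groups\<close>

record ('o, 'm) category =
  Obj :: "'o set"
  Arr :: "'m set"
  Dom :: "'m \<Rightarrow> 'o"
  Cod :: "'m \<Rightarrow> 'o"
  Id :: "'o \<Rightarrow> 'm"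
  Comp :: "'m \<Rightarrow> 'm \<Rightarrow> 'm"

locale category =
  fixes C :: "('o, 'm) category" (structure)
  assumes Dom_Obj: "f \<in> Arr C \<Longrightarrow> Dom C f \<in> Obj C"
    and Cod_Obj: "f \<in> Arr C \<Longrightarrow> Cod C f \<in> Obj C"
    and Id_Arr: "A \<in> Obj C \<Longrightarrow> Id C A \<in> Arr C"
    and Dom_Id: "A \<in> Obj C \<Longrightarrow> Dom C (Id C A) = A"
    and Cod_Id: "A \<in> Obj C \<Longrightarrow> Cod C (Id C A) = A"
    and Comp_Arr: "\<lbrakk>f \<in> Arr C; g \<in> Arr C; Cod C f = Dom C g\<rbrakk> \<Longrightarrow> Comp C g f \<in> Arr C"
    and Dom_Comp: "\<lbrakk>f \<in> Arr C; g \<in> Arr C; Cod C f = Dom C g\<rbrakk> \<Longrightarrow> Dom C (Comp C g f) = Dom C f"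
    and Cod_Comp: "\<lbrakk>f \<in> Arr C; g \<in> Arr C; Cod C f = Dom C g\<rbrakk> \<Longrightarrow> Cod C (Comp C g f) = Cod C g"
    and Comp_Id_right: "f \<in> Arr C \<Longrightarrow> Comp C f (Id C (Dom C f)) = f"
    and Comp_Id_left: "f \<in> Arr C \<Longrightarrow> Comp C (Id C (Cod C f)) f = f"
    and Comp_assoc: "\<lbrakk>f \<in> Arr C; g \<in> Arr C; h \<in> Arr C; Cod C f = Dom C g; Cod C g = Dom C h\<rbrakk>
      \<Longrightarrow> Comp C h (Comp C g f) = Comp C (Comp C h g) f"

text \<open>
  A functor is a pair of an object map and an arrow map. For automorphisms both maps are required
  to be extensional, so that equality of pairs is equality of functors.
\<close>

definition is_functor ::
  "('o, 'm) category \<Rightarrow> ('p, 'n) category \<Rightarrow> ('o \<Rightarrow> 'p) \<times> ('m \<Rightarrow> 'n) \<Rightarrow> bool" where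
  "is_functor C D F \<longleftrightarrow>
     (\<forall>A \<in> Obj C. fst F A \<in> Obj D) \<and>
     (\<forall>f \<in> Arr C. snd F f \<in> Arr D \<and> Dom D (snd F f) = fst F (Dom C f)
        \<and> Cod D (snd F f) = fst F (Cod C f)) \<and>
     (\<forall>A \<in> Obj C. snd F (Id C A) = Id D (fst F A)) \<and>
     (\<forall>f \<in> Arr C. \<forall>g \<in> Arr C. Cod C f = Dom C g \<longrightarrow>
        snd F (Comp C g f) = Comp D (snd F g) (snd F f))"

definition cat_automorphisms :: "('o, 'm) category \<Rightarrow> (('o \<Rightarrow> 'o) \<times> ('m \<Rightarrow> 'm)) set" where
  "cat_automorphisms C = {F. is_functor C C F
     \<and> fst F \<in> extensional (Obj C) \<and> bij_betw (fst F) (Obj C) (Obj C)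
     \<and> snd F \<in> extensional (Arr C) \<and> bij_betw (snd F) (Arr C) (Arr C)}"

definition cat_aut_group :: "('o, 'm) category \<Rightarrow> (('o \<Rightarrow> 'o) \<times> ('m \<Rightarrow> 'm)) monoid" where
  "cat_aut_group C =
    \<lparr>carrier = cat_automorphisms C,
     mult = (\<lambda>F G. (compose (Obj C) (fst F) (fst G), compose (Arr C) (snd F) (snd G))),
     one = (\<lambda>A\<in>Obj C. A, \<lambda>f\<in>Arr C. f)\<rparr>"


section \<open>Free associative algebras\<close>

datatype 'x word = Word (letters: "'x list")

instantiation word :: (type) monoid_add
begin

definition zero_word :: "'x word" where
  "zero_word = Word []"

definition plus_word :: "'x word \<Rightarrow> 'x word \<Rightarrow> 'x word" where
  "plus_word u v = Word (letters u @ letters v)"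

instance
  by standard (simp_all add: zero_word_def plus_word_def)

end

text \<open>
  Addition of words being concatenation, the convolution product on finitely supported functions
  \<^typ>\<open>'x word \<Rightarrow>\<^sub>0 'k\<close> is the product of noncommutative polynomials.
\<close>

type_synonym ('x, 'k) nc_poly = "'x word \<Rightarrow>\<^sub>0 'k"

definition scale :: "'k::field \<Rightarrow> ('x, 'k) nc_poly \<Rightarrow> ('x, 'k) nc_poly" where
  "scale a p = Poly_Mapping.map ((*) a) p"

definition gen :: "'x \<Rightarrow> ('x, 'k::field) nc_poly" where
  "gen x = Poly_Mapping.single (Word [x]) 1"

text \<open>
  Throughout, \<open>unital\<close> selects the variety: algebras with 1 if it is true, algebras not required
  to have 1 if it is false (noncommutative polynomials without constant term).
\<close>

definition free_alg :: "bool \<Rightarrow> 'x set \<Rightarrow> ('x, 'k::field) nc_poly set" where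
  "free_alg unital X =
     {p. \<forall>w \<in> Poly_Mapping.keys p. set (letters w) \<subseteq> X \<and> (unital \<or> letters w \<noteq> [])}"

definition alg_hom ::
  "bool \<Rightarrow> ('x, 'k::field) nc_poly set \<Rightarrow> ('y, 'k) nc_poly set
     \<Rightarrow> (('x, 'k) nc_poly \<Rightarrow> ('y, 'k) nc_poly) \<Rightarrow> bool" where
  "alg_hom unital A B h \<longleftrightarrow>
     h \<in> A \<rightarrow> B \<and>
     (\<forall>u \<in> A. \<forall>v \<in> A. h (u + v) = h u + h v) \<and>
     (\<forall>u \<in> A. \<forall>v \<in> A. h (u * v) = h u * h v) \<and>
     (\<forall>a. \<forall>u \<in> A. h (scale a u) = scale a (h u)) \<and>
     (unital \<longrightarrow> h 1 = 1)"

definition field_aut :: "('k::field \<Rightarrow> 'k) \<Rightarrow> bool" where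
  "field_aut d \<longleftrightarrow> bij d \<and> d 1 = 1 \<and>
     (\<forall>a b. d (a + b) = d a + d b) \<and> (\<forall>a b. d (a * b) = d a * d b)"

definition semi_iso ::
  "bool \<Rightarrow> ('k::field \<Rightarrow> 'k) \<Rightarrow> ('x, 'k) nc_poly set \<Rightarrow> ('y, 'k) nc_poly set
     \<Rightarrow> (('x, 'k) nc_poly \<Rightarrow> ('y, 'k) nc_poly) \<Rightarrow> bool" where
  "semi_iso unital d A B s \<longleftrightarrow>
     field_aut d \<and> bij_betw s A B \<and>
     (\<forall>u \<in> A. \<forall>v \<in> A. s (u + v) = s u + s v) \<and>
     (\<forall>u \<in> A. \<forall>v \<in> A. s (u * v) = s u * s v) \<and>
     (unital \<longrightarrow> s 1 = 1) \<and>
     (\<forall>a. \<forall>u \<in> A. s (scale a u) = scale (d a) (s u))"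

definition word_rev :: "'x word \<Rightarrow> 'x word" where
  "word_rev w = Word (rev (letters w))"

text \<open>
  The coefficient of \<open>reversal p\<close> at \<open>w\<close> is that of \<open>p\<close> at the reversed word (\<open>map_key\<close> is
  precomposition with an injective map). Since this does not depend on the alphabet, the mirror
  anti-automorphism of each free algebra is the restriction of one map.
\<close>

definition reversal :: "('x, 'k::field) nc_poly \<Rightarrow> ('x, 'k) nc_poly" where
  "reversal p = Poly_Mapping.map_key word_rev p"


section \<open>The category of finitely generated free algebras\<close>

text \<open>
  An object \<open>A(X)\<close> is represented by the finite set \<open>X\<close>, which it determines. An arrow records
  its source and target besides the underlying function, which is extensional.
\<close>

datatype ('o, 'f) typed_fun = Arrow (src: 'o) (trg: 'o) (fn: 'f)

type_synonym ('x, 'k) arrow =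
  "('x set, ('x, 'k) nc_poly \<Rightarrow> ('x, 'k) nc_poly) typed_fun"

definition free_alg_cat :: "bool \<Rightarrow> 'x set \<Rightarrow> ('x set, ('x, 'k::field) arrow) category" where
  "free_alg_cat unital X0 =
    \<lparr>Obj = {X. finite X \<and> X \<subseteq> X0},
     Arr = {f. finite (src f) \<and> src f \<subseteq> X0 \<and> finite (trg f) \<and> trg f \<subseteq> X0
        \<and> fn f \<in> extensional (free_alg unital (src f))
        \<and> alg_hom unital (free_alg unital (src f)) (free_alg unital (trg f)) (fn f)},
     Dom = src,
     Cod = trg,
     Id = (\<lambda>X. Arrow X X (\<lambda>u\<in>free_alg unital X. u)),
     Comp = (\<lambda>g f. Arrow (src f) (trg g) (compose (free_alg unital (src f)) (fn g) (fn f)))\<rparr>"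

type_synonym ('x, 'k) free_alg_cat_map =
  "('x set \<Rightarrow> 'x set) \<times> (('x, 'k) arrow \<Rightarrow> ('x, 'k) arrow)"

definition semi_inner_automorphisms :: "bool \<Rightarrow> 'x set \<Rightarrow> ('x, 'k::field) free_alg_cat_map set" where
  "semi_inner_automorphisms unital X0 =
    {F \<in> cat_automorphisms (free_alg_cat unital X0). \<exists>d s.
       (\<forall>X \<in> Obj (free_alg_cat unital X0 :: ('x set, ('x, 'k) arrow) category).
          semi_iso unital d (free_alg unital X) (free_alg unital (fst F X)) (s X)) \<and>
       (\<forall>f \<in> Arr (free_alg_cat unital X0). \<forall>u \<in> free_alg unital (src f).
          fn (snd F f) (s (src f) u) = s (trg f) (fn f u))}"

definition mirror_automorphisms :: "bool \<Rightarrow> 'x set \<Rightarrow> ('x, 'k::field) free_alg_cat_map set" where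
  "mirror_automorphisms unital X0 =
    {F \<in> cat_automorphisms (free_alg_cat unital X0).
       (\<forall>X \<in> Obj (free_alg_cat unital X0 :: ('x set, ('x, 'k) arrow) category). fst F X = X) \<and>
       (\<forall>f \<in> Arr (free_alg_cat unital X0). \<forall>x \<in> src f.
          fn (snd F f) (gen x) = reversal (fn f (gen x)))}"


section \<open>Basic facts\<close>

lemma (in category) group_cat_aut_group: "group (cat_aut_group C)"
proof (rule groupI)
  show "\<one>\<^bsub>cat_aut_group C\<^esub> \<in> carrier (cat_aut_group C)"
    by (auto simp: cat_aut_group_def cat_automorphisms_def is_functor_def Dom_Obj Cod_Obj Id_Arr
        Comp_Arr bij_betw_def inj_on_def)
next
  fix F G assume "F \<in> carrier (cat_aut_group C)" "G \<in> carrier (cat_aut_group C)"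
  then have F: "F \<in> cat_automorphisms C" and G: "G \<in> cat_automorphisms C"
    by (simp_all add: cat_aut_group_def)
  have "bij_betw (compose (Obj C) (fst F) (fst G)) (Obj C) (Obj C)"
    "bij_betw (compose (Arr C) (snd F) (snd G)) (Arr C) (Arr C)"
    using F G by (auto simp: cat_automorphisms_def intro: bij_betw_compose)
  then show "F \<otimes>\<^bsub>cat_aut_group C\<^esub> G \<in> carrier (cat_aut_group C)"
    using F G by (auto simp: cat_aut_group_def cat_automorphisms_def is_functor_def compose_def
        Dom_Obj Cod_Obj Id_Arr Comp_Arr)
next
  fix F G H assume *: "F \<in> carrier (cat_aut_group C)" "G \<in> carrier (cat_aut_group C)"
    "H \<in> carrier (cat_aut_group C)"
  have "fst H \<in> Obj C \<rightarrow> Obj C" "snd H \<in> Arr C \<rightarrow> Arr C"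
    using * by (auto simp: cat_aut_group_def cat_automorphisms_def is_functor_def)
  then show "F \<otimes>\<^bsub>cat_aut_group C\<^esub> G \<otimes>\<^bsub>cat_aut_group C\<^esub> H
      = F \<otimes>\<^bsub>cat_aut_group C\<^esub> (G \<otimes>\<^bsub>cat_aut_group C\<^esub> H)"
    by (auto simp: cat_aut_group_def compose_def fun_eq_iff restrict_def Pi_iff)
next
  fix F assume "F \<in> carrier (cat_aut_group C)"
  then show "\<one>\<^bsub>cat_aut_group C\<^esub> \<otimes>\<^bsub>cat_aut_group C\<^esub> F = F"
    by (auto simp: cat_aut_group_def cat_automorphisms_def is_functor_def compose_def
        extensional_def fun_eq_iff prod_eq_iff)
next
  fix F assume "F \<in> carrier (cat_aut_group C)"
  then have F: "is_functor C C F"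
    "bij_betw (fst F) (Obj C) (Obj C)" "bij_betw (snd F) (Arr C) (Arr C)"
    by (simp_all add: cat_aut_group_def cat_automorphisms_def)
  define o' where "o' = restrict (inv_into (Obj C) (fst F)) (Obj C)"
  define m' where "m' = restrict (inv_into (Arr C) (snd F)) (Arr C)"
  have o_o: "o' (fst F A) = A" "fst F (o' A) = A" "o' A \<in> Obj C" "fst F A \<in> Obj C"
    if "A \<in> Obj C" for A
    using F(2) that unfolding o'_def
    by (auto simp: bij_betw_def inv_into_f_f f_inv_into_f inv_into_into)
  have m_m: "m' (snd F f) = f" "snd F (m' f) = f" "m' f \<in> Arr C" "snd F f \<in> Arr C"
    if "f \<in> Arr C" for f
    using F(3) that unfolding m'_def
    by (auto simp: bij_betw_def inv_into_f_f f_inv_into_f inv_into_into)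
  have dom: "Dom C (m' f) = o' (Dom C f)" and cod: "Cod C (m' f) = o' (Cod C f)"
    if "f \<in> Arr C" for f
    using F(1) that m_m[OF that] o_o(1) unfolding is_functor_def by (metis Dom_Obj Cod_Obj)+
  have idm: "m' (Id C A) = Id C (o' A)" if "A \<in> Obj C" for A
    using F(1) o_o[OF that] m_m(1) Id_Arr unfolding is_functor_def by metis
  have comp: "m' (Comp C g f) = Comp C (m' g) (m' f)"
    if "f \<in> Arr C" "g \<in> Arr C" "Cod C f = Dom C g" for f g
  proof -
    have "Cod C (m' f) = Dom C (m' g)"
      using that by (simp add: dom cod)
    then have "snd F (Comp C (m' g) (m' f)) = Comp C g f" "Comp C (m' g) (m' f) \<in> Arr C"
      using F(1) that m_m unfolding is_functor_def by (auto intro: Comp_Arr)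
    then show ?thesis
      using m_m(1) by metis
  qed
  have "bij_betw o' (Obj C) (Obj C)" "bij_betw m' (Arr C) (Arr C)"
    using o_o m_m by (auto intro!: bij_betwI[where g = "fst F"] bij_betwI[where g = "snd F"])
  then have "(o', m') \<in> carrier (cat_aut_group C)"
    using o_o m_m dom cod idm comp
    by (auto simp: cat_aut_group_def cat_automorphisms_def is_functor_def o'_def[symmetric]
        m'_def[symmetric])
      (auto simp: o'_def m'_def)
  moreover have "(o', m') \<otimes>\<^bsub>cat_aut_group C\<^esub> F = \<one>\<^bsub>cat_aut_group C\<^esub>"
    using o_o m_m by (auto simp: cat_aut_group_def compose_def fun_eq_iff restrict_def)
  ultimately show "\<exists>G \<in> carrier (cat_aut_group C). G \<otimes>\<^bsub>cat_aut_group C\<^esub> F = \<one>\<^bsub>cat_aut_group C\<^esub>"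
    by blast
qed

lemma scale_conv_mult: "scale a p = Poly_Mapping.single 0 a * p"
  by (simp add: scale_def mult_map_scale_conv_mult)

lemma free_alg_closed:
  fixes u v :: "('x, 'k::field) nc_poly"
  shows "u \<in> free_alg unital X \<Longrightarrow> v \<in> free_alg unital X \<Longrightarrow> u + v \<in> free_alg unital X"
    and "u \<in> free_alg unital X \<Longrightarrow> v \<in> free_alg unital X \<Longrightarrow> u * v \<in> free_alg unital X"
    and "u \<in> free_alg unital X \<Longrightarrow> scale a u \<in> free_alg unital X"
    and "unital \<Longrightarrow> (1 :: ('x, 'k) nc_poly) \<in> free_alg unital X"
    and "x \<in> X \<Longrightarrow> (gen x :: ('x, 'k) nc_poly) \<in> free_alg unital X"
proof -
  show "u + v \<in> free_alg unital X" if "u \<in> free_alg unital X" "v \<in> free_alg unital X"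
    using that Poly_Mapping.keys_add[of u v] unfolding free_alg_def by blast
  show "u * v \<in> free_alg unital X" if "u \<in> free_alg unital X" "v \<in> free_alg unital X"
    using that keys_mult[of u v] unfolding free_alg_def by (fastforce simp: plus_word_def)
  show "scale a u \<in> free_alg unital X" if "u \<in> free_alg unital X"
    using that keys_mult[of "Poly_Mapping.single 0 a" u] unfolding free_alg_def scale_conv_mult
    by (fastforce split: if_splits)
  show "(1 :: ('x, 'k) nc_poly) \<in> free_alg unital X" if unital
    using that by (simp add: free_alg_def zero_word_def)
  show "(gen x :: ('x, 'k) nc_poly) \<in> free_alg unital X" if "x \<in> X"
    using that by (simp add: free_alg_def gen_def)
qed

lemma category_free_alg_cat:
  "category (free_alg_cat unital X0 :: ('x set, ('x, 'k::field) arrow) category)"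
proof
  fix f g :: "('x, 'k) arrow"
  assume "f \<in> Arr (free_alg_cat unital X0)" "g \<in> Arr (free_alg_cat unital X0)"
    "Cod (free_alg_cat unital X0) f = Dom (free_alg_cat unital X0) g"
  then show "Comp (free_alg_cat unital X0) g f \<in> Arr (free_alg_cat unital X0)"
    by (auto simp: free_alg_cat_def alg_hom_def compose_def Pi_iff free_alg_closed)
next
  fix f g h :: "('x, 'k) arrow"
  assume "f \<in> Arr (free_alg_cat unital X0)" "g \<in> Arr (free_alg_cat unital X0)"
    "h \<in> Arr (free_alg_cat unital X0)"
    "Cod (free_alg_cat unital X0) f = Dom (free_alg_cat unital X0) g"
    "Cod (free_alg_cat unital X0) g = Dom (free_alg_cat unital X0) h"
  then show "Comp (free_alg_cat unital X0) h (Comp (free_alg_cat unital X0) g f)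
      = Comp (free_alg_cat unital X0) (Comp (free_alg_cat unital X0) h g) f"
    by (auto simp: free_alg_cat_def alg_hom_def compose_def fun_eq_iff restrict_def Pi_iff)
qed (auto simp: free_alg_cat_def alg_hom_def compose_def extensional_def fun_eq_iff Pi_iff
    free_alg_closed intro!: typed_fun.expand)

lemma group_Aut_free_alg_cat:
  "group (cat_aut_group (free_alg_cat unital X0 :: ('x set, ('x, 'k::field) arrow) category))"
  by (rule category.group_cat_aut_group[OF category_free_alg_cat])

lemma inj_word_rev: "inj word_rev"
  by (metis injI letters_def word_rev_def rev_rev_ident word.collapse word.sel)

lemma lookup_reversal: "Poly_Mapping.lookup (reversal p) w = Poly_Mapping.lookup p (word_rev w)"
  by (simp add: reversal_def map_key.rep_eq[OF inj_word_rev])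

lemma reversal_single:
  "reversal (Poly_Mapping.single (Word xs) a) = Poly_Mapping.single (Word (rev xs)) a"
  using map_key_single[OF inj_word_rev, of "Word (rev xs)" a]
  by (simp add: reversal_def word_rev_def)

lemma reversal_gen: "reversal (gen x) = gen x"
  by (simp add: gen_def reversal_single)

end

theory Submission
  imports Defs
begin

text \<open>
  Let \<open>F\<close> be an automorphism of the category. It maps a singleton \<open>{x0}\<close> to a singleton, so elements of
  \<open>A(X)\<close>, viewed as homomorphisms \<open>A({x0}) \<rightarrow> A(X)\<close>, are transported by \<open>F\<close>. After subtracting the image of
  \<open>0\<close> this gives bijections \<open>s X : A(X) \<rightarrow> A(F X)\<close> with \<open>F(\<nu>) \<circ> s X = s Y \<circ> \<nu>\<close>, and composing with
  isomorphisms one may assume that they fix the free generators and \<open>0\<close>. Then the operations transported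
  along \<open>s\<close> are given by noncommutative polynomials, such as \<open>p = s (x + y)\<close>.

  These polynomials are determined with the right derivative \<open>\<partial>\<^sub>x\<close>, which reads off the words ending
  in \<open>x\<close>. By its chain rule, \<open>\<partial>\<^sub>x\<close> of an invertible substitution is a unit, hence a scalar; so
  the only word of \<open>p\<close> ending in \<open>x\<close> is \<open>x\<close>, and by symmetry \<open>p = x + y\<close>. In the same way \<open>s\<close> is
  semilinear. Differentiating the biadditivity of \<open>q = s (x y)\<close> gives \<open>q = a x y + b y x\<close>, and
  associativity gives \<open>a b = 0\<close>. Hence a scalar multiple of \<open>s\<close> is a semi-isomorphism or an
  anti-semi-isomorphism, and accordingly \<open>F\<close> or its product with the mirror automorphism is semi-inner.
\<close>

section \<open>Noncommutative polynomials and substitution\<close>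

lemma poly_mapping_eq_sum_single:
  "p = (\<Sum>w\<in>Poly_Mapping.keys p. Poly_Mapping.single w (Poly_Mapping.lookup p w))"
proof (rule poly_mapping_eqI)
  fix k
  have "(\<Sum>w\<in>Poly_Mapping.keys p. Poly_Mapping.lookup p w when w = k)
      = (if k \<in> Poly_Mapping.keys p then Poly_Mapping.lookup p k else 0)"
    by (simp add: when_def)
  then show "Poly_Mapping.lookup p k = Poly_Mapping.lookup
      (\<Sum>w\<in>Poly_Mapping.keys p. Poly_Mapping.single w (Poly_Mapping.lookup p w)) k"
    by (simp add: lookup_sum lookup_single in_keys_iff)
qed

text \<open>The monomials range only over the support of \<open>p\<close> itself, so that conditions
  on the support, such as membership in a free algebra, reach the monomial case.\<close>

lemma poly_mapping_add_induct [case_names zero single add]: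
  fixes p :: "'a \<Rightarrow>\<^sub>0 'b::comm_monoid_add"
  assumes "P 0" and "\<And>w a. w \<in> Poly_Mapping.keys p \<Longrightarrow> P (Poly_Mapping.single w a)"
    and "\<And>u v. P u \<Longrightarrow> P v \<Longrightarrow> P (u + v)"
  shows "P p"
proof -
  have "P (\<Sum>w\<in>A. Poly_Mapping.single w (Poly_Mapping.lookup p w))"
    if "finite A" "A \<subseteq> Poly_Mapping.keys p" for A
    using that by (induction A) (auto intro: assms)
  from this[of "Poly_Mapping.keys p"] show ?thesis
    by (simp flip: poly_mapping_eq_sum_single)
qed

lemma word_add: "Word u + Word v = Word (u @ v)"
  by (simp add: plus_word_def)

lemma letters_zero [simp]: "letters 0 = []"
    and letters_add [simp]: "letters (u + v) = letters u @ letters v"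
  by (simp_all add: plus_word_def zero_word_def)

lemma word_eq_iff: "u = v \<longleftrightarrow> letters u = letters v"
  by (cases u; cases v) simp

lemma word_eq_zero_iff: "w = 0 \<longleftrightarrow> letters w = []"
  by (simp add: word_eq_iff)

lemma lookup_scale: "Poly_Mapping.lookup (scale a p) w = a * Poly_Mapping.lookup p w"
  by (simp add: scale_def Poly_Mapping.map.rep_eq when_def)

lemma scale_single [simp]: "scale a (Poly_Mapping.single w b) = Poly_Mapping.single w (a * b)"
  by (simp add: scale_conv_mult mult_single)

lemma scale_zero_right [simp]: "scale a 0 = 0"
  by (simp add: scale_conv_mult)

lemma scale_zero_left [simp]: "scale 0 p = 0"
  by (simp add: scale_conv_mult)

lemma scale_one [simp]: "scale 1 p = p"
  by (simp add: scale_conv_mult)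

lemma scale_add_right: "scale a (p + q) = scale a p + scale a q"
  by (simp add: scale_conv_mult distrib_left)

lemma scale_add_left: "scale (a + b) p = scale a p + scale b p"
  by (simp add: scale_conv_mult distrib_right single_add)

lemma scale_scale [simp]: "scale a (scale b p) = scale (a * b) p"
  by (simp add: scale_conv_mult mult_single flip: mult.assoc)

lemma mult_scale_left [simp]: "scale a p * q = scale a (p * q)"
  by (simp add: scale_conv_mult mult.assoc)

lemma mult_scale_right [simp]: "p * scale a q = scale a (p * q)"
proof -
  \<comment> \<open>Constants are central: the empty word commutes with every word and the field is
    commutative.\<close>
  have "p * Poly_Mapping.single 0 a = Poly_Mapping.single 0 a * p"
    by (induction p rule: poly_mapping_add_induct) (simp_all add: mult_single mult.commute
        distrib_left distrib_right)
  then show ?thesis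
    by (metis scale_conv_mult mult.assoc)
qed

lemma scale_minus_one: "scale (-1) p = - p"
  by (simp add: poly_mapping_eq_iff lookup_scale fun_eq_iff)

lemma gen_neq_zero [simp]: "gen x \<noteq> (0 :: ('x, 'k::field) nc_poly)"
  unfolding gen_def by (metis lookup_single_eq lookup_zero zero_neq_one)

lemma lookup_gen_zero [simp]: "Poly_Mapping.lookup (gen x) 0 = 0"
  by (simp add: gen_def lookup_single zero_word_def)

text \<open>Evaluation of a polynomial at \<open>f\<close>, the homomorphism given by the universal
  property. The empty word goes to the empty product 1, so one map serves both varieties: without 1,
  elements contain no empty word.\<close>

definition subst :: "('x \<Rightarrow> ('y, 'k) nc_poly) \<Rightarrow> ('x, 'k::field) nc_poly \<Rightarrow> ('y, 'k) nc_poly" where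
  "subst f p = (\<Sum>w\<in>Poly_Mapping.keys p. scale (Poly_Mapping.lookup p w) (prod_list (map f (letters
      w))))"

text \<open>Additivity needs a common index set, because the support of a sum may be smaller than
  the union of the supports.\<close>

lemma subst_superset:
  assumes "finite A" "Poly_Mapping.keys p \<subseteq> A"
  shows "subst f p = (\<Sum>w\<in>A. scale (Poly_Mapping.lookup p w) (prod_list (map f (letters w))))"
  unfolding subst_def using assms by (intro sum.mono_neutral_left) (auto simp: in_keys_iff)

lemma subst_zero [simp]: "subst f 0 = 0"
  by (simp add: subst_def)

lemma subst_single: "subst f (Poly_Mapping.single w a) = scale a (prod_list (map f (letters w)))"
  by (subst subst_superset[of "{w}"]) auto

lemma subst_gen [simp]: "subst f (gen x) = f x"
  by (simp add: gen_def subst_single)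

lemma subst_const [simp]: "subst f (Poly_Mapping.single 0 a) = Poly_Mapping.single 0 a"
  by (simp add: subst_single flip: single_one)

lemma subst_one [simp]: "subst f 1 = 1"
  by (simp flip: single_one)

lemma subst_add [simp]: "subst f (p + q) = subst f p + subst f q"
proof -
  let ?A = "Poly_Mapping.keys p \<union> Poly_Mapping.keys q"
  have "Poly_Mapping.keys (p + q) \<subseteq> ?A"
    by (rule Poly_Mapping.keys_add)
  then show ?thesis
    by (simp add: subst_superset[of ?A] lookup_add scale_add_left sum.distrib)
qed

lemma subst_mult [simp]: "subst f (p * q) = subst f p * subst f q"
proof (induction p rule: poly_mapping_add_induct)
  case (single w a)
  show ?case
    by (induction q rule: poly_mapping_add_induct)
      (simp_all add: mult_single subst_single distrib_left mult.commute)
qed (simp_all add: distrib_right)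

lemma subst_scale [simp]: "subst f (scale a p) = scale a (subst f p)"
  by (simp add: scale_conv_mult)

lemma subst_minus [simp]: "subst f (- p) = - subst f p"
  by (simp flip: scale_minus_one)

lemma subst_diff [simp]: "subst f (p - q) = subst f p - subst f q"
  by (metis subst_add subst_minus diff_conv_add_uminus)

lemma subst_subst: "subst f (subst g p) = subst (\<lambda>x. subst f (g x)) p"
proof (induction p rule: poly_mapping_add_induct)
  case (single w a)
  have "subst f (prod_list (map g xs)) = prod_list (map (\<lambda>x. subst f (g x)) xs)" for xs
    by (induction xs) auto
  then show ?case
    by (simp add: subst_single)
qed auto

lemma subst_gen_id [simp]: "subst gen p = (p :: ('x, 'k::field) nc_poly)"
proof (induction p rule: poly_mapping_add_induct)
  case (single w a)
  have "prod_list (map gen xs) = Poly_Mapping.single (Word xs) (1::'k)" for xs :: "'x list"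
    by (induction xs) (auto simp: gen_def mult_single word_add simp flip: zero_word_def)
  from this[of "letters w"] show ?case
    by (simp add: subst_single)
qed auto

lemma subst_zero_fun: "subst (\<lambda>_. 0) p = Poly_Mapping.single 0 (Poly_Mapping.lookup p 0)"
proof (induction p rule: poly_mapping_add_induct)
  case (single w a)
  show ?case
    by (cases "letters w") (auto simp: subst_single lookup_single word_eq_zero_iff when_def
        simp flip: single_one)
qed (simp_all add: lookup_add single_add)

text \<open>The constant term is evaluation at 0, and evaluation is multiplicative.\<close>

lemma lookup_mult_zero:
  "Poly_Mapping.lookup (p * q) (0::'x word)
      = Poly_Mapping.lookup p 0 * Poly_Mapping.lookup (q :: ('x, 'k::field) nc_poly) 0"
proof -
  have "Poly_Mapping.single 0 (Poly_Mapping.lookup (p * q) 0)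
      = Poly_Mapping.single (0::'x word) (Poly_Mapping.lookup p 0 * Poly_Mapping.lookup q 0)"
    using subst_mult[of "\<lambda>_. 0 :: ('x, 'k) nc_poly" p q]
    by (simp only: subst_zero_fun mult_single add_0)
  then show ?thesis
    by (metis lookup_single_eq)
qed

section \<open>Free algebras inside the polynomials and their universal property\<close>

lemma free_alg_mono: "p \<in> free_alg unital X \<Longrightarrow> p \<in> free_alg True X"
  by (auto simp: free_alg_def)

lemma zero_in_free_alg [simp]: "0 \<in> free_alg unital X"
  by (simp add: free_alg_def)

lemma diff_in_free_alg:
  fixes u v :: "('x, 'k::field) nc_poly"
  assumes "u \<in> free_alg unital X" "v \<in> free_alg unital X"
  shows "u - v \<in> free_alg unital X"
proof -
  have "u - v = u + scale (-1) v"
    by (simp add: scale_minus_one)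
  then show ?thesis
    using free_alg_closed(1)[OF assms(1) free_alg_closed(3)[OF assms(2), of "- 1"]]
    by (simp only:)
qed

lemma single_in_free_alg:
  "set (letters w) \<subseteq> X \<Longrightarrow> unital \<or> letters w \<noteq> [] \<Longrightarrow> Poly_Mapping.single w a \<in> free_alg unital X"
  by (simp add: free_alg_def)

lemma free_alg_induct [consumes 1, case_names zero single add]:
  fixes p :: "('x, 'k::field) nc_poly"
  assumes "p \<in> free_alg unital X" and "P 0"
    and "\<And>xs a. set xs \<subseteq> X \<Longrightarrow> unital \<or> xs \<noteq> [] \<Longrightarrow> P (Poly_Mapping.single (Word xs) a)"
    and "\<And>u v. u \<in> free_alg unital X \<Longrightarrow> v \<in> free_alg unital X \<Longrightarrow> P u \<Longrightarrow> P v \<Longrightarrow> P (u + v)"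
  shows "P p"
proof -
  have "p \<in> free_alg unital X \<and> P p"
  proof (induction p rule: poly_mapping_add_induct)
    case (single w a)
    then have "set (letters w) \<subseteq> X" "unital \<or> letters w \<noteq> []"
      using assms(1) by (auto simp: free_alg_def)
    then show ?case
      using assms(3)[of "letters w" a] by (simp add: single_in_free_alg)
  qed (auto intro: assms free_alg_closed)
  then show ?thesis ..
qed

lemma subst_cong:
  assumes "u \<in> free_alg unital X" "\<And>x. x \<in> X \<Longrightarrow> f x = g x"
  shows "subst f u = subst g u"
  using assms(1)
proof (induction rule: free_alg_induct)
  case (single xs a)
  then have "map f xs = map g xs"
    using assms(2) by auto
  then show ?case
    by (simp only: subst_single word.sel)
qed auto

lemma subst_in_free_alg:
  assumes "u \<in> free_alg unital X" "f \<in> X \<rightarrow> free_alg unital Y"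
  shows "subst f u \<in> free_alg unital Y"
  using assms(1)
proof (induction rule: free_alg_induct)
  case (single xs a)
  have "prod_list (map f xs) \<in> free_alg unital Y" if "set xs \<subseteq> X" "unital \<or> xs \<noteq> []"
    using that
  proof (induction xs)
    case (Cons x xs)
    then show ?case
      using assms(2) by (cases "xs = []") (auto intro: free_alg_closed)
  qed (auto intro: free_alg_closed)
  then show ?case
    using single by (simp add: subst_single free_alg_closed)
qed (auto intro: free_alg_closed)

lemma alg_hom_subst:
  assumes "f \<in> X \<rightarrow> free_alg unital Y"
  shows "alg_hom unital (free_alg unital X) (free_alg unital Y) (subst f)"
  using assms by (auto simp: alg_hom_def intro: subst_in_free_alg)

text \<open>Uniqueness in the universal property: additivity and linearity reduce the claim to
  words, and words are products of letters.\<close>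

lemma alg_hom_eq_subst:
  fixes h :: "('x, 'k::field) nc_poly \<Rightarrow> ('y, 'k) nc_poly"
  assumes h: "alg_hom unital (free_alg unital X) B h" and u: "u \<in> free_alg unital X"
  shows "h u = subst (\<lambda>x. h (gen x)) u"
  using u
proof (induction rule: free_alg_induct)
  case zero
  have "h (scale 0 0) = scale 0 (h 0)"
    using h unfolding alg_hom_def by (metis zero_in_free_alg)
  then show ?case by simp
next
  case (single xs a)
  have "h (Poly_Mapping.single (Word xs) 1) = prod_list (map (\<lambda>x. h (gen x)) xs)"
    if "set xs \<subseteq> X" "unital \<or> xs \<noteq> []"
    using that
  proof (induction xs)
    case Nil
    then show ?case
      using h by (simp add: alg_hom_def flip: zero_word_def)
  next
    case (Cons x xs)
    \<comment> \<open>Without 1 a word may be split into its first letter and its tail only if the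
      tail is nonempty; one-letter words are therefore a separate case.\<close>
    show ?case
    proof (cases "xs = []")
      case False
      have "Poly_Mapping.single (Word (x # xs)) 1 = gen x * Poly_Mapping.single (Word xs) (1::'k)"
        by (simp add: gen_def mult_single word_add)
      moreover have "gen x \<in> (free_alg unital X :: ('x, 'k) nc_poly set)"
        "Poly_Mapping.single (Word xs) 1 \<in> (free_alg unital X :: ('x, 'k) nc_poly set)"
        using Cons.prems False by (auto intro!: free_alg_closed single_in_free_alg)
      ultimately have "h (Poly_Mapping.single (Word (x # xs)) 1)
          = h (gen x) * h (Poly_Mapping.single (Word xs) 1)"
        using h by (simp add: alg_hom_def)
      then show ?thesis
        using Cons False by auto
    qed (simp add: gen_def)
  qed
  moreover have "Poly_Mapping.single (Word xs) 1 \<in> (free_alg unital X :: ('x, 'k) nc_poly set)"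
    using single by (auto intro!: single_in_free_alg)
  then have "h (scale a (Poly_Mapping.single (Word xs) 1))
      = scale a (h (Poly_Mapping.single (Word xs) 1))"
    using h unfolding alg_hom_def by blast
  ultimately show ?case
    using single by (simp add: subst_single)
next
  case (add u v)
  then show ?case
    using h by (simp add: alg_hom_def)
qed

section \<open>Right derivatives\<close>

text \<open>This is the Fox derivative of the free algebra, with the constant term as
  augmentation.\<close>

definition rderiv :: "'x \<Rightarrow> ('x, 'k::field) nc_poly \<Rightarrow> ('x, 'k) nc_poly" where
  "rderiv a p = Poly_Mapping.map_key (\<lambda>w. w + Word [a]) p"

lemma inj_snoc_word: "inj (\<lambda>w. w + Word [a])"
  by (auto intro!: injI simp: word_eq_iff)

lemma lookup_rderiv: "Poly_Mapping.lookup (rderiv a p) w = Poly_Mapping.lookup p (w + Word [a])"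
  by (simp add: rderiv_def map_key.rep_eq[OF inj_snoc_word])

lemma rderiv_zero [simp]: "rderiv a 0 = 0"
  by (simp add: poly_mapping_eq_iff fun_eq_iff lookup_rderiv)

lemma rderiv_add [simp]: "rderiv a (p + q) = rderiv a p + rderiv a q"
  by (simp add: poly_mapping_eq_iff fun_eq_iff lookup_rderiv lookup_add)

lemma rderiv_scale [simp]: "rderiv a (scale c p) = scale c (rderiv a p)"
  by (simp add: poly_mapping_eq_iff fun_eq_iff lookup_rderiv lookup_scale)

lemma rderiv_const [simp]: "rderiv a (Poly_Mapping.single 0 c) = 0"
  by (simp add: poly_mapping_eq_iff fun_eq_iff lookup_rderiv lookup_single when_def word_eq_iff)

lemma rderiv_mult_gen: "rderiv a (p * gen b) = (if a = b then p else 0)"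
proof (induction p rule: poly_mapping_add_induct)
  case (single w c)
  show ?case
    by (auto simp: gen_def mult_single poly_mapping_eq_iff fun_eq_iff lookup_rderiv lookup_single
        when_def word_eq_iff)
qed (auto simp: distrib_right)

lemma rderiv_gen [simp]: "rderiv a (gen b) = (if a = b then 1 else 0)"
  using rderiv_mult_gen[of a 1 b] by simp

lemma single_snoc: "Poly_Mapping.single (Word (us @ [b])) c
    = Poly_Mapping.single (Word us) c * gen b"
  by (simp add: gen_def mult_single word_add)

lemma nc_poly_induct [case_names const mult_gen add]:
  fixes p :: "('x, 'k::field) nc_poly"
  assumes "\<And>c. P (Poly_Mapping.single 0 c)" "\<And>q b. P (q * gen b)"
    "\<And>u v. P u \<Longrightarrow> P v \<Longrightarrow> P (u + v)"
  shows "P p"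
proof (induction p rule: poly_mapping_add_induct)
  case zero
  show ?case using assms(1)[of 0] by simp
next
  case (single w a)
  show ?case
  proof (cases w)
    case (Word xs)
    show ?thesis
      by (cases xs rule: rev_cases)
        (use assms(1) in \<open>auto simp: Word single_snoc assms simp flip: zero_word_def\<close>)
  qed
qed (fact assms)

text \<open>The last letter of a product of two words is that of the second word, unless the second
  word is empty; hence the constant term of \<open>q\<close> in the correction.\<close>

lemma rderiv_mult:
  "rderiv a (p * q) = p * rderiv a q + scale (Poly_Mapping.lookup q 0) (rderiv a p)"
proof (induction q rule: nc_poly_induct)
  case (const c)
  have "p * Poly_Mapping.single 0 c = scale c p"
    using mult_scale_right[of p c 1] by (simp add: scale_conv_mult)
  then show ?case by simp
next
  case (mult_gen q b)
  have "rderiv a ((p * q) * gen b) = (if a = b then p * q else 0)"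
    by (rule rderiv_mult_gen)
  then show ?case
    by (simp add: rderiv_mult_gen lookup_mult_zero mult.assoc)
qed (simp_all add: distrib_left lookup_add scale_add_left)

text \<open>The Fox chain rule sums over all letters \<open>b\<close> the terms
  \<open>subst f (rderiv b p) * rderiv a (f b)\<close>; the second hypothesis leaves only
  \<open>b = c\<close>. The vanishing constant terms remove the corrections of the product
  rule.\<close>

lemma rderiv_subst:
  assumes "\<And>b. Poly_Mapping.lookup (f b) 0 = 0" and "\<And>b. b \<noteq> c \<Longrightarrow> rderiv a (f b) = 0"
  shows "rderiv a (subst f p) = subst f (rderiv c p) * rderiv a (f c)"
proof (induction p rule: nc_poly_induct)
  case (mult_gen q b)
  then show ?case
    using assms(2)[of b] by (auto simp: rderiv_mult rderiv_mult_gen assms(1))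
qed (auto simp: distrib_right)

text \<open>Leading words: if \<open>w\<close> and \<open>v\<close> are longest in \<open>p\<close>
  and \<open>q\<close>, nothing cancels the coefficient of \<open>w + v\<close> in the product, so
  \<open>w + v\<close> must be the empty word.\<close>

lemma mult_eq_one_imp_const:
  fixes p q :: "('x, 'k::field) nc_poly"
  assumes "p * q = 1"
  obtains c where "q = Poly_Mapping.single 0 c"
proof -
  have ne: "Poly_Mapping.keys p \<noteq> {}" "Poly_Mapping.keys q \<noteq> {}"
    using assms by auto
  have ex: "\<exists>w \<in> Poly_Mapping.keys r. \<forall>v
      \<in> Poly_Mapping.keys r. length (letters v) \<le> length (letters w)"
    if "Poly_Mapping.keys r \<noteq> {}" for r :: "('x, 'k) nc_poly"
  proof -
    let ?l = "\<lambda>w :: 'x word. length (letters w)"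
    have "Max (?l ` Poly_Mapping.keys r) \<in> ?l ` Poly_Mapping.keys r"
      using that by (intro Max_in) auto
    then obtain w where "w \<in> Poly_Mapping.keys r" "?l w = Max (?l ` Poly_Mapping.keys r)"
      by auto
    then show ?thesis
      by (metis Max_ge finite_imageI finite_keys imageI)
  qed
  obtain w where w: "w \<in> Poly_Mapping.keys p"
      "\<And>v. v \<in> Poly_Mapping.keys p \<Longrightarrow> length (letters v) \<le> length (letters w)"
    using ex[OF ne(1)] by auto
  obtain v where v: "v \<in> Poly_Mapping.keys q"
      "\<And>u. u \<in> Poly_Mapping.keys q \<Longrightarrow> length (letters u) \<le> length (letters v)"
    using ex[OF ne(2)] by auto
  \<comment> \<open>Both factors have at most the maximal length, so equal total length forces equal
    lengths, and then the two concatenations match factor by factor.\<close>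
  have split: "w' = w \<and> v' = v"
      if "w' \<in> Poly_Mapping.keys p" "v' \<in> Poly_Mapping.keys q" "w' + v' = w + v" for w' v'
  proof -
    have "letters w' @ letters v' = letters w @ letters v"
      using that(3) by (simp add: word_eq_iff)
    moreover from this have "length (letters w') + length (letters v')
        = length (letters w) + length (letters v)"
      by (metis length_append)
    then have "length (letters w') = length (letters w)"
      using w(2)[OF that(1)] v(2)[OF that(2)] by linarith
    ultimately show ?thesis
      by (simp add: word_eq_iff)
  qed
  have "p * q = (\<Sum>w'\<in>Poly_Mapping.keys p. \<Sum>v'\<in>Poly_Mapping.keys q.
      Poly_Mapping.single (w' + v') (Poly_Mapping.lookup p w' * Poly_Mapping.lookup q v'))"
    by (subst (1) poly_mapping_eq_sum_single[of p], subst (1) poly_mapping_eq_sum_single[of q])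
      (simp add: sum_product mult_single)
  then have "Poly_Mapping.lookup (p * q) (w + v)
      = (\<Sum>w'\<in>Poly_Mapping.keys p. \<Sum>v'\<in>Poly_Mapping.keys q.
      Poly_Mapping.lookup p w' * Poly_Mapping.lookup q v' when w' + v' = w + v)"
    by (simp add: lookup_sum lookup_single)
  also have "\<dots> = (\<Sum>w'\<in>Poly_Mapping.keys p. \<Sum>v'\<in>Poly_Mapping.keys q.
      if v' = v then (if w' = w then Poly_Mapping.lookup p w * Poly_Mapping.lookup q v else 0) else
          0)"
    by (intro sum.cong) (auto simp: when_def dest: split)
  also have "\<dots> = Poly_Mapping.lookup p w * Poly_Mapping.lookup q v"
    using w(1) v(1) by simp
  also have "\<dots> \<noteq> 0"
    using w(1) v(1) by (simp add: in_keys_iff)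
  finally have "w + v = 0"
    by (simp add: assms lookup_one when_def split: if_splits)
  then have "letters v = []"
    by (metis letters_add letters_zero append_is_Nil_conv)
  then have "Poly_Mapping.keys q \<subseteq> {0}"
    using v(2) by (auto simp: word_eq_zero_iff)
  then have "q = Poly_Mapping.single 0 (Poly_Mapping.lookup q 0)"
    by (auto simp: poly_mapping_eq_iff fun_eq_iff lookup_single when_def in_keys_iff subset_iff)
  then show thesis ..
qed

lemma rderiv_in_free_alg:
  assumes "p \<in> free_alg unital X"
  shows "rderiv a p \<in> free_alg True X"
proof -
  have "set (letters w) \<subseteq> X" if "w \<in> Poly_Mapping.keys (rderiv a p)" for w
  proof -
    have "w + Word [a] \<in> Poly_Mapping.keys p"
      using that by (simp add: in_keys_iff lookup_rderiv)
    then show ?thesis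
      using assms by (fastforce simp: free_alg_def)
  qed
  then show ?thesis
    by (simp add: free_alg_def)
qed

text \<open>Nonempty words are sorted by their last letter. A polynomial is thus known from its
  constant term and its derivatives, which is how all the explicit forms below are obtained.\<close>

lemma free_alg_decompose:
  fixes p :: "('x, 'k::field) nc_poly"
  assumes "p \<in> free_alg unital X" "finite X"
  shows "p = Poly_Mapping.single 0 (Poly_Mapping.lookup p 0) + (\<Sum>x\<in>X. rderiv x p * gen x)"
  using assms(1)
proof (induction rule: free_alg_induct)
  case (single xs a)
  show ?case
  proof (cases xs rule: rev_cases)
    case Nil
    then show ?thesis
      by (simp flip: zero_word_def)
  next
    case (snoc us b)
    let ?q = "Poly_Mapping.single (Word us) a :: ('x, 'k) nc_poly"
    have "(\<Sum>x\<in>X. rderiv x (?q * gen b) * gen x) = (\<Sum>x\<in>X. if x = b then ?q * gen b else 0)"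
      by (intro sum.cong) (auto simp: rderiv_mult_gen)
    also have "\<dots> = ?q * gen b"
      using single snoc assms(2) by simp
    finally show ?thesis
      by (simp add: snoc single_snoc lookup_mult_zero)
  qed
next
  case (add u v)
  have "Poly_Mapping.single 0 (Poly_Mapping.lookup (u + v) 0) + (\<Sum>x\<in>X. rderiv x (u + v) * gen x)
    = (Poly_Mapping.single 0 (Poly_Mapping.lookup u 0) + (\<Sum>x\<in>X. rderiv x u * gen x))
      + (Poly_Mapping.single 0 (Poly_Mapping.lookup v 0) + (\<Sum>x\<in>X. rderiv x v * gen x))"
    by (simp add: lookup_add single_add distrib_right sum.distrib)
  then show ?case
    using add.IH by simp
qed simp

section \<open>Substitutions in two letters and biadditive polynomials\<close>

definition subst2 ::
  "'x \<Rightarrow> ('y, 'k) nc_poly \<Rightarrow> 'x \<Rightarrow> ('y, 'k) nc_poly \<Rightarrow> ('x, 'k::field) nc_poly \<Rightarrow> ('y, 'k) nc_poly" where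
  "subst2 x u y v = subst ((\<lambda>_. 0)(x := u, y := v))"

lemma subst2_simps [simp]:
  "subst2 x u y v 0 = 0" "subst2 x u y v 1 = 1"
  "subst2 x u y v (Poly_Mapping.single 0 a) = Poly_Mapping.single 0 a"
  "subst2 x u y v (p + q) = subst2 x u y v p + subst2 x u y v q"
  "subst2 x u y v (p - q) = subst2 x u y v p - subst2 x u y v q"
  "subst2 x u y v (p * q) = subst2 x u y v p * subst2 x u y v q"
  "subst2 x u y v (scale a p) = scale a (subst2 x u y v p)"
  "x \<noteq> y \<Longrightarrow> subst2 x u y v (gen x) = u"
  "subst2 x u y v (gen y) = v"
  by (simp_all add: subst2_def)

lemma subst2_swap: "x \<noteq> y \<Longrightarrow> subst2 y v x u = subst2 x u y v"
  by (simp add: subst2_def fun_upd_twist)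

lemma subst2_zero:
  "subst2 x 0 y 0 p = (Poly_Mapping.single 0 (Poly_Mapping.lookup p 0) :: ('y, 'k::field) nc_poly)"
proof -
  have "(\<lambda>_. 0 :: ('y, 'k) nc_poly)(x := 0, y := 0) = (\<lambda>_. 0)"
    by auto
  then show ?thesis
    unfolding subst2_def by (simp only: subst_zero_fun)
qed

lemma subst_subst2: "subst f (subst2 x u y v p) = subst2 x (subst f u) y (subst f v) p"
proof -
  have "(\<lambda>b. subst f (((\<lambda>_. 0)(x := u, y := v)) b)) = (\<lambda>_. 0)(x := subst f u, y := subst f v)"
    by auto
  then show ?thesis
    by (simp add: subst2_def subst_subst)
qed

lemma subst2_subst2:
  "subst2 x u y v (subst2 x' u' y' v' p) = subst2 x' (subst2 x u y v u') y' (subst2 x u y v v') p"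
  unfolding subst2_def[of x u y v] by (rule subst_subst2)

lemma subst2_gen_id:
  assumes "p \<in> free_alg unital {x, y}"
  shows "subst2 x (gen x) y (gen y) p = p"
proof -
  have "subst2 x (gen x) y (gen y) p = subst gen p"
    unfolding subst2_def by (rule subst_cong[OF assms]) auto
  then show ?thesis by simp
qed

lemma rderiv_subst2:
  assumes "x \<noteq> y" "Poly_Mapping.lookup u 0 = 0" "Poly_Mapping.lookup v 0 = 0"
  shows "rderiv a v = 0 \<Longrightarrow> rderiv a (subst2 x u y v p) = subst2 x u y v (rderiv x p) * rderiv a u"
    and "rderiv a u = 0 \<Longrightarrow> rderiv a (subst2 x u y v p) = subst2 x u y v (rderiv y p) * rderiv a v"
  using rderiv_subst[of "(\<lambda>_. 0)(x := u, y := v)" x a p]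
    rderiv_subst[of "(\<lambda>_. 0)(x := u, y := v)" y a p] assms
  by (auto simp: subst2_def)

text \<open>The chain rule makes the derivative of an invertible substitution invertible.\<close>

lemma rderiv_const_of_left_inverse:
  assumes "x \<noteq> y" "Poly_Mapping.lookup p 0 = 0" "subst2 x p y (gen y) q = gen x"
  obtains r where "rderiv x p = Poly_Mapping.single 0 r"
proof -
  have "subst2 x p y (gen y) (rderiv x q) * rderiv x p = rderiv x (subst2 x p y (gen y) q)"
    using assms(1,2) by (simp add: rderiv_subst2(1))
  then have "subst2 x p y (gen y) (rderiv x q) * rderiv x p = 1"
    by (simp add: assms(3))
  then show thesis
    using that by (rule mult_eq_one_imp_const)
qed

text \<open>Additivity in \<open>x\<close> is differentiated by the new letter \<open>z\<close> and
  by \<open>y\<close>: the former shows that the \<open>x\<close>-derivative is free of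
  \<open>x\<close>, the latter that the \<open>y\<close>-derivative is again additive in
  \<open>x\<close>.\<close>

lemma biadditive_rderiv:
  fixes f :: "('x, 'k::field) nc_poly"
  assumes xyz: "x \<noteq> y" "x \<noteq> z" "y \<noteq> z" and f: "f \<in> free_alg True {x, y}"
    and add: "subst2 x (gen x + gen z) y (gen y) f
      = subst2 x (gen x) y (gen y) f + subst2 x (gen z) y (gen y) f"
  shows "Poly_Mapping.lookup f 0 = 0" and "rderiv x f = subst2 x 0 y (gen y) (rderiv x f)"
    and "subst2 x (gen x + gen z) y (gen y) (rderiv y f)
      = subst2 x (gen x) y (gen y) (rderiv y f) + subst2 x (gen z) y (gen y) (rderiv y f)"
proof -
  have "subst (\<lambda>_. 0 :: ('x, 'k) nc_poly) (subst2 x (gen x + gen z) y (gen y) f)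
      = subst (\<lambda>_. 0) (subst2 x (gen x) y (gen y) f + subst2 x (gen z) y (gen y) f)"
    by (simp only: add)
  then have "Poly_Mapping.single (0::'x word) (Poly_Mapping.lookup f 0)
      = Poly_Mapping.single 0 (Poly_Mapping.lookup f 0)
          + Poly_Mapping.single 0 (Poly_Mapping.lookup f 0)"
    by (simp add: subst_subst2 subst2_zero)
  then show "Poly_Mapping.lookup f 0 = 0"
    by (metis lookup_single_eq add_cancel_right_right lookup_add)
next
  \<comment> \<open>The summand in \<open>x\<close> and \<open>y\<close> alone has no word ending in
    \<open>z\<close>, so it disappears.\<close>
  have "rderiv z (subst2 x (gen x + gen z) y (gen y) f)
      = rderiv z (subst2 x (gen x) y (gen y) f + subst2 x (gen z) y (gen y) f)"
    by (simp only: add)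
  then have "subst2 x (gen x + gen z) y (gen y) (rderiv x f)
      = subst2 x (gen z) y (gen y) (rderiv x f)"
    using xyz by (simp add: rderiv_subst2(1) lookup_add)
  \<comment> \<open>Now \<open>z\<close> is set to 0, while \<open>x\<close> and \<open>y\<close>
    are kept.\<close>
  then have "subst ((\<lambda>_. 0)(x := gen x, y := gen y)) (subst2 x (gen x
      + gen z) y (gen y) (rderiv x f))
      = subst ((\<lambda>_. 0)(x := gen x, y := gen y)) (subst2 x (gen z) y (gen y) (rderiv x f))"
    by (simp only:)
  then have "subst2 x (gen x) y (gen y) (rderiv x f) = subst2 x 0 y (gen y) (rderiv x f)"
    using xyz by (simp add: subst_subst2)
  then show "rderiv x f = subst2 x 0 y (gen y) (rderiv x f)"
    by (simp add: subst2_gen_id[OF rderiv_in_free_alg[OF f]])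
next
  have "rderiv y (subst2 x (gen x + gen z) y (gen y) f)
      = rderiv y (subst2 x (gen x) y (gen y) f + subst2 x (gen z) y (gen y) f)"
    by (simp only: add)
  then show "subst2 x (gen x + gen z) y (gen y) (rderiv y f)
      = subst2 x (gen x) y (gen y) (rderiv y f) + subst2 x (gen z) y (gen y) (rderiv y f)"
    using xyz by (simp add: rderiv_subst2(2) lookup_add)
qed

text \<open>The derivative by \<open>x\<close> is free of \<open>x\<close> by additivity in
  \<open>x\<close>, and still additive in \<open>y\<close>. The preceding lemma, applied to it with
  the letters exchanged, makes its own derivative by \<open>y\<close> a constant.\<close>

lemma biadditive_rderiv_linear:
  fixes f :: "('x, 'k::field) nc_poly"
  assumes xyz: "x \<noteq> y" "x \<noteq> z" "y \<noteq> z" and f: "f \<in> free_alg True {x, y}"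
    and add1: "subst2 x (gen x + gen z) y (gen y) f
      = subst2 x (gen x) y (gen y) f + subst2 x (gen z) y (gen y) f"
    and add2: "subst2 x (gen x) y (gen y + gen z) f
      = subst2 x (gen x) y (gen y) f + subst2 x (gen x) y (gen z) f"
  obtains r where "rderiv x f = scale r (gen y)"
proof -
  let ?g = "rderiv x f"
  have g: "?g \<in> free_alg True {x, y}"
    using f by (rule rderiv_in_free_alg)
  have g0: "?g = subst2 x 0 y (gen y) ?g"
    using biadditive_rderiv(2)[OF xyz f add1] .
  have add: "subst2 y (gen y + gen z) x (gen x) ?g
      = subst2 y (gen y) x (gen x) ?g + subst2 y (gen z) x (gen x) ?g"
    using biadditive_rderiv(3)[of y x z f] xyz f add2 by (simp add: subst2_swap insert_commute)
  have e: "Poly_Mapping.lookup ?g 0 = 0" and gy: "rderiv y ?g = subst2 x (gen x) y 0 (rderiv y ?g)"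
    using biadditive_rderiv[of y x z ?g] xyz g add by (simp_all add: subst2_swap insert_commute)
  have "rderiv x ?g = rderiv x (subst2 x 0 y (gen y) ?g)"
    using g0 by simp
  then have gx: "rderiv x ?g = 0"
    using xyz by (simp add: rderiv_subst2(1))
  have "rderiv y ?g = rderiv y (subst2 x 0 y (gen y) ?g)"
    using g0 by simp
  then have "rderiv y ?g = subst2 x 0 y (gen y) (rderiv y ?g)"
    using xyz by (simp add: rderiv_subst2(2))
  \<comment> \<open>\<open>gy\<close> removes the letter \<open>y\<close> and the preceding equation
    removes \<open>x\<close>; only the constant term remains.\<close>
  then have "rderiv y ?g = subst2 x 0 y 0 (rderiv y ?g)"
    using gy xyz by (metis subst2_subst2 subst2_simps(1,8,9))
  then have "rderiv y ?g = Poly_Mapping.single 0 (Poly_Mapping.lookup (rderiv y ?g) 0)"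
    by (simp only: subst2_zero)
  moreover have "?g = rderiv y ?g * gen y"
    using free_alg_decompose[OF g] e gx xyz by simp
  ultimately show thesis
    using that by (metis scale_conv_mult)
qed

lemma biadditive_form:
  fixes f :: "('x, 'k::field) nc_poly"
  assumes xyz: "x \<noteq> y" "x \<noteq> z" "y \<noteq> z" and f: "f \<in> free_alg True {x, y}"
    and add1: "subst2 x (gen x + gen z) y (gen y) f
      = subst2 x (gen x) y (gen y) f + subst2 x (gen z) y (gen y) f"
    and add2: "subst2 x (gen x) y (gen y + gen z) f
      = subst2 x (gen x) y (gen y) f + subst2 x (gen x) y (gen z) f"
  obtains a b where "f = scale a (gen x * gen y) + scale b (gen y * gen x)"
proof -
  obtain b where b: "rderiv x f = scale b (gen y)"
    using biadditive_rderiv_linear[OF assms] .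
  obtain a where a: "rderiv y f = scale a (gen x)"
    using biadditive_rderiv_linear[of y x z f] xyz f add1 add2
    by (auto simp add: subst2_swap insert_commute)
  show thesis
    using free_alg_decompose[OF f] biadditive_rderiv(1)[OF xyz f add1] xyz a b that
    by (simp add: add.commute)
qed

section \<open>Conjugations fixing the generators\<close>

text \<open>
  Up to an isomorphism \<open>A(X) \<rightarrow> F(A(X))\<close>, an automorphism \<open>F\<close> of the category acts as conjugation
  by a family \<open>t\<close> as follows.
\<close>

locale conjugating_family =
  fixes unital :: bool and X0 :: "'x set"
      and t :: "'x set \<Rightarrow> ('x, 'k::field) nc_poly \<Rightarrow> ('x, 'k) nc_poly"
  assumes infinite_X0: "infinite X0"
    and t_bij: "finite X \<Longrightarrow> X \<subseteq> X0 \<Longrightarrow> bij_betw (t X) (free_alg unital X) (free_alg unital X)"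
    and t_gen: "finite X \<Longrightarrow> X \<subseteq> X0 \<Longrightarrow> x \<in> X \<Longrightarrow> t X (gen x) = gen x"
    and t_zero: "finite X \<Longrightarrow> X \<subseteq> X0 \<Longrightarrow> t X 0 = 0"
    and t_subst: "finite X \<Longrightarrow> X \<subseteq> X0 \<Longrightarrow> finite Y \<Longrightarrow> Y \<subseteq> X0 \<Longrightarrow> f \<in> X \<rightarrow> free_alg unital Y
      \<Longrightarrow> u \<in> free_alg unital X \<Longrightarrow> t Y (subst f u) = subst (\<lambda>x. t Y (f x)) (t X u)"
begin

lemma t_in: "finite X \<Longrightarrow> X \<subseteq> X0 \<Longrightarrow> u \<in> free_alg unital X \<Longrightarrow> t X u \<in> free_alg unital X"
  using t_bij by (auto simp: bij_betw_def)

text \<open>All letters other than \<open>x\<close> and \<open>y\<close> are sent to 0, which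
  \<open>t\<close> fixes, so the equivariance law keeps the two-letter shape.\<close>

lemma t_subst2:
  assumes "x \<noteq> y" "{x, y} \<subseteq> X0" "finite Z" "Z \<subseteq> X0"
    and "u \<in> free_alg unital Z" "v \<in> free_alg unital Z" "q \<in> free_alg unital {x, y}"
  shows "t Z (subst2 x u y v q) = subst2 x (t Z u) y (t Z v) (t {x, y} q)"
proof -
  let ?f = "(\<lambda>_. 0)(x := u, y := v)"
  have "t Z (subst2 x u y v q) = subst (\<lambda>b. t Z (?f b)) (t {x, y} q)"
    unfolding subst2_def using assms by (intro t_subst) auto
  also have "\<dots> = subst2 x (t Z u) y (t Z v) (t {x, y} q)"
    unfolding subst2_def using assms by (intro subst_cong[OF t_in]) auto
  finally show ?thesis .
qed

text \<open>The constant term is the image under the homomorphism to the free algebra on the empty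
  set that kills both letters; \<open>t\<close> commutes with it and fixes 0.\<close>

lemma lookup_t_zero:
  assumes "x \<noteq> y" "{x, y} \<subseteq> X0" "q \<in> free_alg unital {x, y}" "Poly_Mapping.lookup q 0 = 0"
  shows "Poly_Mapping.lookup (t {x, y} q) 0 = 0"
proof -
  have "t {} (subst2 x 0 y 0 q) = subst2 x (t {} 0) y (t {} 0) (t {x, y} q)"
    using assms by (intro t_subst2) auto
  then have "Poly_Mapping.single (0::'x word) (Poly_Mapping.lookup (t {x, y} q) 0) = 0"
    using assms(4) by (simp add: t_zero subst2_zero)
  then show ?thesis
    by (metis lookup_single_eq lookup_zero)
qed

text \<open>The axioms are symmetric under inversion; this yields surjectivity of the scalar map
  \<open>\<rho>\<close> below.\<close>

lemma conjugating_family_inverse: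
  "conjugating_family unital X0 (\<lambda>X. inv_into (free_alg unital X) (t X))"
proof
  fix X assume X: "finite X" "X \<subseteq> X0"
  note b = t_bij[OF X]
  show "bij_betw (inv_into (free_alg unital X) (t X)) (free_alg unital X) (free_alg unital X)"
    using b by (rule bij_betw_inv_into)
  show "inv_into (free_alg unital X) (t X) 0 = 0"
    using bij_betw_inv_into_left[OF b, of 0] t_zero[OF X] by simp
  show "inv_into (free_alg unital X) (t X) (gen x) = gen x" if "x \<in> X" for x
    using bij_betw_inv_into_left[OF b, of "gen x"] t_gen[OF X that] that
        by (simp add: free_alg_closed)
  fix Y and f :: "'x \<Rightarrow> ('x, 'k) nc_poly" and u :: "('x, 'k) nc_poly"
  assume Y: "finite Y" "Y \<subseteq> X0" and f: "f \<in> X \<rightarrow> free_alg unital Y" and u: "u \<in> free_alg unital X"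
  define g where "g = (\<lambda>x. inv_into (free_alg unital Y) (t Y) (f x))"
  define v where "v = inv_into (free_alg unital X) (t X) u"
  have v: "v \<in> free_alg unital X" "t X v = u"
    unfolding v_def using b u
    by (metis bij_betw_def inv_into_into, metis bij_betw_inv_into_right)
  have g: "g \<in> X \<rightarrow> free_alg unital Y" "\<And>x. x \<in> X \<Longrightarrow> t Y (g x) = f x"
    unfolding g_def using t_bij[OF Y] f
    by (metis (no_types, lifting) Pi_iff bij_betw_def inv_into_into)
      (metis Pi_iff f t_bij[OF Y] bij_betw_inv_into_right)
  \<comment> \<open>Equivariance of \<open>t\<close> at the preimages \<open>g\<close> and
    \<open>v\<close> is the desired law after applying \<open>t Y\<close>, which is
    injective.\<close>
  have "t Y (subst g v) = subst f u"
    using t_subst[OF X Y g(1) v(1)] v(2) subst_cong[OF u, of "\<lambda>x. t Y (g x)" f] g(2) by simp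
  moreover have "subst g v \<in> free_alg unital Y"
    using v(1) g(1) by (rule subst_in_free_alg)
  ultimately show "inv_into (free_alg unital Y) (t Y) (subst f u) = subst g v"
    using bij_betw_inv_into_left[OF t_bij[OF Y]] by metis
qed (rule infinite_X0)

section \<open>Scalars and sums under a conjugating family\<close>

lemma ex_letters:
  obtains x y z where "x \<in> X0" "y \<in> X0" "z \<in> X0" "x \<noteq> y" "x \<noteq> z" "y \<noteq> z"
proof -
  obtain x where "x \<in> X0" using infinite_X0 by fastforce
  moreover obtain y where "y \<in> X0 - {x}"
    using infinite_X0 by (metis Diff_infinite_finite finite.emptyI finite_insert ex_in_conv)
  moreover obtain z where "z \<in> X0 - {x, y}"
    using infinite_X0 by (metis Diff_infinite_finite finite.emptyI finite_insert ex_in_conv)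
  ultimately show thesis using that by auto
qed

text \<open>It suffices to find the image \<open>p\<close> of \<open>scale a (gen x)\<close>, since
  \<open>x\<close> can be replaced by any element. The letter \<open>y\<close> only serves to make
  the two-letter lemmas applicable.\<close>

lemma t_scale_ex:
  "\<exists>r. \<forall>X u. finite X \<longrightarrow> X \<subseteq> X0 \<longrightarrow> u \<in> free_alg unital X \<longrightarrow> t X (scale a u) = scale r (t X u)"
proof (cases "a = 0")
  case True
  then show ?thesis
    by (intro exI[of _ 0]) (simp add: t_zero)
next
  case False
  obtain x y z where xy: "x \<in> X0" "y \<in> X0" "x \<noteq> y"
    by (rule ex_letters)
  define A where "A = (free_alg unital {x, y} :: ('x, 'k) nc_poly set)"
  have gens: "gen x \<in> A" "gen y \<in> A"
    by (simp_all add: A_def free_alg_closed)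
  note s2 = t_subst2[OF xy(3), of "{x, y}"]
  define p where "p = t {x, y} (scale a (gen x))"
  have p: "p \<in> A"
    using xy gens unfolding p_def A_def by (intro t_in free_alg_closed) auto
  have ep: "Poly_Mapping.lookup p 0 = 0"
    unfolding p_def using xy gens
        by (intro lookup_t_zero) (auto simp: A_def lookup_scale free_alg_closed)
  \<comment> \<open>Multiplication by \<open>1 / a\<close> undoes multiplication by
    \<open>a\<close>; transporting this identity exhibits \<open>p\<close> as an invertible
    substitution.\<close>
  have "t {x, y} (subst2 x (scale a (gen x)) y (gen y) (scale (1 / a) (gen x)))
      = subst2 x p y (gen y) (t {x, y} (scale (1 / a) (gen x)))"
    unfolding p_def using xy gens s2[of "scale a (gen x)" "gen y" "scale (1 / a) (gen x)"]
    by (simp add: A_def free_alg_closed t_gen)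
  then have "subst2 x p y (gen y) (t {x, y} (scale (1 / a) (gen x))) = gen x"
    using xy False by (simp add: t_gen)
  then obtain r where r: "rderiv x p = Poly_Mapping.single 0 r"
    using rderiv_const_of_left_inverse[OF xy(3) ep] by blast
  \<comment> \<open>The original element is unchanged by setting \<open>y\<close> to 0, hence so is
    its image.\<close>
  have "p = subst2 x (gen x) y 0 p"
    using s2[of "gen x" 0 "scale a (gen x)"] xy gens
    by (simp add: A_def p_def free_alg_closed t_gen t_zero)
  then have "rderiv y p = rderiv y (subst2 x (gen x) y 0 p)"
    by simp
  then have "rderiv y p = 0"
    using xy by (simp add: rderiv_subst2(2))
  then have pr: "p = scale r (gen x)"
    using free_alg_decompose[of p unital "{x, y}"] p r ep xy by (simp add: A_def scale_conv_mult)
  show ?thesis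
  proof (intro exI[of _ r] allI impI)
    fix X and u :: "('x, 'k) nc_poly"
    assume X: "finite X" "X \<subseteq> X0" and u: "u \<in> free_alg unital X"
    \<comment> \<open>Equivariance under \<open>x := u\<close> carries the same scalar
      \<open>r\<close> to every element of every free algebra.\<close>
    have "t X (subst2 x u y 0 (scale a (gen x))) = subst2 x (t X u) y (t X 0) p"
      unfolding p_def using xy gens X u by (intro t_subst2) (auto simp: A_def free_alg_closed)
    then show "t X (scale a u) = scale r (t X u)"
      using xy by (simp add: pr)
  qed
qed

text \<open>The choice is forced: a scalar is determined by its multiple of one generator, see
  \<open>\<rho>_unique\<close>.\<close>

definition \<rho> :: "'k \<Rightarrow> 'k" where
  "\<rho> a = (SOME r. \<forall>X u. finite X \<longrightarrow> X \<subseteq> X0 \<longrightarrow> u \<in> free_alg unital X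
      \<longrightarrow> t X (scale a u) = scale r (t X u))"

lemma t_scale:
  "finite X \<Longrightarrow> X \<subseteq> X0 \<Longrightarrow> u \<in> free_alg unital X \<Longrightarrow> t X (scale a u) = scale (\<rho> a) (t X u)"
  using someI_ex[OF t_scale_ex[of a]] unfolding \<rho>_def by blast

text \<open>Invertibility makes the derivative by \<open>x\<close> a scalar, symmetry gives the same
  scalar for \<open>y\<close>, and setting \<open>y\<close> to 0 shows that it is 1.\<close>

lemma t_sum_gens:
  assumes xy: "x \<in> X0" "y \<in> X0" "x \<noteq> y"
  shows "t {x, y} (gen x + gen y) = gen x + gen y"
proof -
  define A where "A = (free_alg unital {x, y} :: ('x, 'k) nc_poly set)"
  have gens: "gen x \<in> A" "gen y \<in> A" "gen x + gen y \<in> A" "gen x - gen y \<in> A"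
    by (simp_all add: A_def free_alg_closed diff_in_free_alg)
  have s2: "t {x, y} (subst2 x u y v q) = subst2 x (t {x, y} u) y (t {x, y} v) (t {x, y} q)"
    if "u \<in> A" "v \<in> A" "q \<in> A" for u v q
    using t_subst2[OF xy(3)] xy that by (simp add: A_def)
  define p where "p = t {x, y} (gen x + gen y)"
  have p: "p \<in> A"
    using xy gens unfolding p_def A_def by (intro t_in) auto
  have ep: "Poly_Mapping.lookup p 0 = 0"
    unfolding p_def using xy gens by (intro lookup_t_zero) (auto simp: A_def lookup_add)
  \<comment> \<open>The inverse substitution comes from \<open>x = (x + y) - y\<close>.\<close>
  have "subst2 x p y (gen y) (t {x, y} (gen x - gen y))
      = t {x, y} (subst2 x (gen x + gen y) y (gen y) (gen x - gen y))"
    using s2[of "gen x + gen y" "gen y" "gen x - gen y"] xy gens by (simp add: t_gen p_def)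
  also have "\<dots> = gen x"
    using xy by (simp add: t_gen)
  finally obtain r where r: "rderiv x p = Poly_Mapping.single 0 r"
    using rderiv_const_of_left_inverse[OF xy(3) ep] by blast
  \<comment> \<open>Exchanging the two letters fixes the sum, hence \<open>p\<close>.\<close>
  have "t {x, y} (subst2 x (gen y) y (gen x) (gen x + gen y)) = subst2 x (gen y) y (gen x) p"
    using s2[of "gen y" "gen x" "gen x + gen y"] xy gens by (simp add: t_gen p_def)
  then have "p = subst2 x (gen y) y (gen x) p"
    using xy by (simp add: p_def add.commute)
  then have "rderiv y p = rderiv y (subst2 x (gen y) y (gen x) p)"
    by simp
  also have "\<dots> = Poly_Mapping.single 0 r"
    using xy r by (simp add: rderiv_subst2(1))
  finally have pr: "p = scale r (gen x) + scale r (gen y)"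
    using free_alg_decompose[of p unital "{x, y}"] p r ep xy by (simp add: A_def scale_conv_mult)
  have "t {x, y} (subst2 x (gen x) y 0 (gen x + gen y)) = subst2 x (gen x) y 0 p"
    using s2[of "gen x" 0 "gen x + gen y"] xy gens by (simp add: t_gen t_zero p_def A_def)
  then have "scale r (gen x) = gen x"
    using xy pr by (simp add: t_gen)
  then have "Poly_Mapping.lookup (scale r (gen x) :: ('x, 'k) nc_poly) (Word [x])
      = Poly_Mapping.lookup (gen x) (Word [x])"
    by simp
  then have "r = 1"
    by (simp add: lookup_scale gen_def)
  then show ?thesis
    using pr by (simp add: p_def)
qed

lemma t_add:
  assumes X: "finite X" "X \<subseteq> X0" "u \<in> free_alg unital X" "v \<in> free_alg unital X"
  shows "t X (u + v) = t X u + t X v"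
proof -
  obtain x y z where xy: "x \<in> X0" "y \<in> X0" "x \<noteq> y"
    by (rule ex_letters)
  have "t X (subst2 x u y v (gen x + gen y))
      = subst2 x (t X u) y (t X v) (t {x, y} (gen x + gen y))"
    using xy X by (intro t_subst2) (auto intro: free_alg_closed)
  then show ?thesis
    using xy by (simp add: t_sum_gens)
qed

section \<open>The field automorphism and the transported product\<close>

lemma scale_gen_inject: "scale a (gen x) = scale b (gen x :: ('x, 'k) nc_poly) \<longleftrightarrow> a = b"
  unfolding poly_mapping_eq_iff fun_eq_iff lookup_scale
  by (auto simp: gen_def lookup_single when_def)

lemma t_scale_gen:
  assumes "x \<in> X0"
  shows "t {x} (scale a (gen x)) = scale (\<rho> a) (gen x)"
  using assms t_scale[of "{x}" "gen x" a] t_gen[of "{x}" x] by (simp add: free_alg_closed)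

lemma \<rho>_unique:
  assumes "x \<in> X0" "t {x} (scale a (gen x)) = scale b (gen x)"
  shows "\<rho> a = b"
  using assms t_scale_gen[of x a] by (simp add: scale_gen_inject)

text \<open>Every law of \<open>\<rho>\<close> is read off at multiples of a single generator, where
  scalars can be recovered.\<close>

lemma field_aut_\<rho>: "field_aut \<rho>"
proof -
  interpret inv: conjugating_family unital X0 "\<lambda>X. inv_into (free_alg unital X) (t X)"
    by (rule conjugating_family_inverse)
  obtain x y z where x: "x \<in> X0"
    by (rule ex_letters)
  then have X: "finite {x}" "{x} \<subseteq> X0"
    by auto
  have mem: "scale a (gen x) \<in> free_alg unital {x}" for a :: 'k
    by (simp add: free_alg_closed)
  have "inj \<rho>"
  proof (rule injI)
    fix a b assume "\<rho> a = \<rho> b"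
    then have "t {x} (scale a (gen x)) = t {x} (scale b (gen x))"
      using x by (simp add: t_scale_gen)
    then have "scale a (gen x) = scale b (gen x :: ('x, 'k) nc_poly)"
      using t_bij[OF X] mem by (metis bij_betw_def inj_onD)
    then show "a = b"
      by (simp add: scale_gen_inject)
  qed
  \<comment> \<open>The scalar map of the inverse family is a right inverse.\<close>
  moreover have "\<rho> (inv.\<rho> b) = b" for b
    using \<rho>_unique[OF x] inv.t_scale_gen[OF x, of b] bij_betw_inv_into_right[OF t_bij[OF X] mem]
        by metis
  then have "surj \<rho>"
    by (metis surjI)
  moreover have "\<rho> 1 = 1"
    using x X by (intro \<rho>_unique[of x]) (simp_all add: t_gen)
  moreover have "\<rho> (a + b) = \<rho> a + \<rho> b" for a b
    using x X mem by (intro \<rho>_unique[of x]) (simp_all add: scale_add_left t_add t_scale_gen)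
  moreover have "\<rho> (a * b) = \<rho> a * \<rho> b" for a b
    using x X t_scale[OF X mem, of a b] by (intro \<rho>_unique[of x]) (simp_all add: t_scale_gen)
  ultimately show ?thesis
    by (simp add: field_aut_def bij_def)
qed

text \<open>The image \<open>q\<close> of the product of two generators is biadditive, so it
  combines the product and the opposite product; associativity permits only one of them, and
  injectivity of \<open>t\<close> excludes none.\<close>

lemma t_mult:
  obtains c where "c \<noteq> 0"
    and "\<And>X u v. finite X \<Longrightarrow> X \<subseteq> X0 \<Longrightarrow> u \<in> free_alg unital X \<Longrightarrow> v \<in> free_alg unital X
      \<Longrightarrow> t X (u * v) = scale c (t X u * t X v)"
  | c where "c \<noteq> 0"
    and "\<And>X u v. finite X \<Longrightarrow> X \<subseteq> X0 \<Longrightarrow> u \<in> free_alg unital X \<Longrightarrow> v \<in> free_alg unital X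
      \<Longrightarrow> t X (u * v) = scale c (t X v * t X u)"
proof -
  obtain x y z where xyz: "x \<in> X0" "y \<in> X0" "z \<in> X0" "x \<noteq> y" "x \<noteq> z" "y \<noteq> z"
    by (rule ex_letters)
  let ?Z = "{x, y, z}"
  define q where "q = t {x, y} (gen x * gen y)"
  have Z: "finite ?Z" "?Z \<subseteq> X0"
    using xyz by auto
  have s2: "t X (u * v) = subst2 x (t X u) y (t X v) q"
    if "finite X" "X \<subseteq> X0" "u \<in> free_alg unital X" "v \<in> free_alg unital X" for X u v
    using t_subst2[OF xyz(4), of X u v "gen x * gen y"] xyz that
    by (simp add: free_alg_closed q_def)
  have mem: "gen x \<in> (free_alg unital ?Z :: ('x, 'k) nc_poly set)"
    "gen y \<in> (free_alg unital ?Z :: ('x, 'k) nc_poly set)"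
    "gen z \<in> (free_alg unital ?Z :: ('x, 'k) nc_poly set)"
    by (simp_all add: free_alg_closed)
  have tg: "t ?Z (gen x) = gen x" "t ?Z (gen y) = gen y" "t ?Z (gen z) = gen z"
    using Z by (simp_all add: t_gen)
  \<comment> \<open>The distributive laws, transported by the additive \<open>t\<close>, become
    biadditivity of \<open>q\<close>.\<close>
  have "t ?Z ((gen x + gen z) * gen y) = t ?Z (gen x * gen y) + t ?Z (gen z * gen y)"
    "t ?Z (gen x * (gen y + gen z)) = t ?Z (gen x * gen y) + t ?Z (gen x * gen z)"
    using Z mem by (simp_all add: t_add distrib_left distrib_right free_alg_closed)
  then have add: "subst2 x (gen x + gen z) y (gen y) q
      = subst2 x (gen x) y (gen y) q + subst2 x (gen z) y (gen y) q"
    "subst2 x (gen x) y (gen y + gen z) q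
      = subst2 x (gen x) y (gen y) q + subst2 x (gen x) y (gen z) q"
    using Z mem by (simp_all only: s2 free_alg_closed(1) t_add tg)
  have "q \<in> free_alg unital {x, y}"
    using xyz unfolding q_def by (intro t_in) (auto intro: free_alg_closed)
  then have "q \<in> free_alg True {x, y}"
    by (rule free_alg_mono)
  then obtain a b where q: "q = scale a (gen x * gen y) + scale b (gen y * gen x)"
    using biadditive_form[OF xyz(4-6) _ add] by blast
  have tm: "t X (u * v) = scale a (t X u * t X v) + scale b (t X v * t X u)"
    if "finite X" "X \<subseteq> X0" "u \<in> free_alg unital X" "v \<in> free_alg unital X" for X u v
    using s2[OF that] xyz by (simp add: q)
  have g3: "gen p * (gen q * gen r) = Poly_Mapping.single (Word [p, q, r]) (1::'k)" for p q r :: 'x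
    by (simp add: gen_def mult_single word_add)
  have "t ?Z ((gen x * gen y) * gen z)
      = scale a ((scale a (gen x * gen y) + scale b (gen y * gen x)) * gen z)
        + scale b (gen z * (scale a (gen x * gen y) + scale b (gen y * gen x)))"
    "t ?Z (gen x * (gen y * gen z))
      = scale a (gen x * (scale a (gen y * gen z) + scale b (gen z * gen y)))
        + scale b ((scale a (gen y * gen z) + scale b (gen z * gen y)) * gen x)"
    using Z mem by (simp_all only: tm free_alg_closed(2) tg)
  then have "scale a ((scale a (gen x * gen y) + scale b (gen y * gen x)) * gen z)
        + scale b (gen z * (scale a (gen x * gen y) + scale b (gen y * gen x)))
      = scale a (gen x * (scale a (gen y * gen z) + scale b (gen z * gen y)))
        + scale b ((scale a (gen y * gen z) + scale b (gen z * gen y)) * gen x)"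
    by (metis mult.assoc)
  then have eq: "scale (a * a) (gen x * (gen y * gen z)) + scale (a * b) (gen y * (gen x * gen z))
      + scale (b * a) (gen z * (gen x * gen y)) + scale (b * b) (gen z * (gen y * gen x))
    = scale (a * a) (gen x * (gen y * gen z)) + scale (a * b) (gen x * (gen z * gen y))
      + scale (b * a) (gen y * (gen z * gen x)) + scale (b * b) (gen z * (gen y * gen x))"
    by (simp add: scale_add_right distrib_left distrib_right mult.assoc add.assoc)
  \<comment> \<open>The word \<open>yxz\<close> occurs only on the left of the associativity
    equation, with coefficient \<open>a * b\<close>.\<close>
  have "Poly_Mapping.lookup (scale (a * a) (gen x * (gen y * gen z))
      + scale (a * b) (gen y * (gen x * gen z))
      + scale (b * a) (gen z * (gen x * gen y))
          + scale (b * b) (gen z * (gen y * gen x))) (Word [y, x, z]) = a * b"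
    using xyz unfolding g3 by (auto simp: lookup_add lookup_single)
  moreover have "Poly_Mapping.lookup (scale (a * a) (gen x * (gen y * gen z))
      + scale (a * b) (gen x * (gen z * gen y))
      + scale (b * a) (gen y * (gen z * gen x))
          + scale (b * b) (gen z * (gen y * gen x))) (Word [y, x, z]) = 0"
    using xyz unfolding g3 by (auto simp: lookup_add lookup_single)
  ultimately have "a * b = 0"
    by (simp only: eq)
  moreover have "a \<noteq> 0 \<or> b \<noteq> 0"
  proof (rule ccontr)
    assume "\<not> ?thesis"
    then have "t ?Z (gen x * gen y) = t ?Z 0"
      using Z mem by (simp add: tm t_zero)
    then have "gen x * gen y = (0 :: ('x, 'k) nc_poly)"
      using t_bij[OF Z] mem by (metis bij_betw_def inj_onD free_alg_closed(2) zero_in_free_alg)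
    then have "rderiv y (gen x * gen y) = (0 :: ('x, 'k) nc_poly)"
      by simp
    then show False
      by (simp add: rderiv_mult_gen)
  qed
  ultimately consider "a \<noteq> 0" "b = 0" | "b \<noteq> 0" "a = 0"
    by auto
  then show thesis
    using that tm by cases auto
qed

end

section \<open>Automorphisms of the category\<close>

lemma reversal_add: "reversal (p + q) = reversal p + reversal q"
  by (simp add: poly_mapping_eq_iff fun_eq_iff lookup_reversal lookup_add)

lemma reversal_zero [simp]: "reversal 0 = 0"
  by (simp add: poly_mapping_eq_iff fun_eq_iff lookup_reversal)

lemma reversal_scale: "reversal (scale a p) = scale a (reversal p)"
  by (simp add: poly_mapping_eq_iff fun_eq_iff lookup_reversal lookup_scale)

lemma reversal_reversal [simp]: "reversal (reversal p) = p"
  by (simp add: poly_mapping_eq_iff fun_eq_iff lookup_reversal word_rev_def)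

lemma reversal_one [simp]: "reversal 1 = 1"
  using reversal_single[of "[]" 1] by (simp flip: zero_word_def)

lemma reversal_mult: "reversal (p * q) = reversal q * reversal p"
proof (induction p rule: poly_mapping_add_induct)
  case (single u a)
  show ?case
  proof (induction q rule: poly_mapping_add_induct)
    case (single v b)
    show ?case
      by (cases u; cases v) (simp add: mult_single reversal_single word_add mult.commute)
  qed (simp_all add: distrib_left distrib_right reversal_add)
qed (simp_all add: distrib_left distrib_right reversal_add)

lemma reversal_in_free_alg:
  assumes "p \<in> free_alg unital X"
  shows "reversal p \<in> free_alg unital X"
  using assms
proof (induction rule: free_alg_induct)
  case (single xs a)
  then show ?case
    by (auto simp: reversal_single intro!: single_in_free_alg)
qed (auto simp: reversal_add intro: free_alg_closed)

lemma mult_commute_free_alg_singleton: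
  assumes "u \<in> free_alg unital {x}" "v \<in> free_alg unital {x}"
  shows "u * v = v * u"
  using assms(1)
proof (induction rule: free_alg_induct)
  case (single xs a)
  show ?case
    using assms(2)
  proof (induction rule: free_alg_induct)
    case (single ys b)
    have "xs = replicate (length xs) x" "ys = replicate (length ys) x"
      using \<open>set xs \<subseteq> {x}\<close> \<open>set ys \<subseteq> {x}\<close>
          by (auto simp: replicate_length_same subset_iff intro!: sym[OF replicate_length_same])
    then have "xs @ ys = ys @ xs"
      by (metis replicate_add add.commute)
    then show ?case
      by (simp add: mult_single word_add mult.commute)
  qed (simp_all add: distrib_left distrib_right)
qed (simp_all add: distrib_left distrib_right)

lemma gen_mult_commute_iff: "gen x * gen y = (gen y * gen x :: ('x, 'k::field) nc_poly) \<longleftrightarrow> x = y"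
proof
  assume "gen x * gen y = (gen y * gen x :: ('x, 'k) nc_poly)"
  then have "rderiv y (gen x * gen y) = rderiv y (gen y * gen x :: ('x, 'k) nc_poly)"
    by simp
  then show "x = y"
    by (auto simp: rderiv_mult_gen split: if_splits)
qed simp

text \<open>Preservation of 1 is automatic: if \<open>e\<close> is a preimage of 1, then
  \<open>s 1 = s 1 * s e = s e = 1\<close>.\<close>

lemma semi_isoI:
  fixes s :: "('x, 'k::field) nc_poly \<Rightarrow> ('y, 'k) nc_poly"
  assumes "field_aut d" and bij: "bij_betw s (free_alg unital X) (free_alg unital Y)"
    and "\<And>u v. u \<in> free_alg unital X \<Longrightarrow> v \<in> free_alg unital X \<Longrightarrow> s (u + v) = s u + s v"
    and mult: "\<And>u v. u \<in> free_alg unital X \<Longrightarrow> v \<in> free_alg unital X \<Longrightarrow> s (u * v) = s u * s v"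
    and "\<And>a u. u \<in> free_alg unital X \<Longrightarrow> s (scale a u) = scale (d a) (s u)"
  shows "semi_iso unital d (free_alg unital X) (free_alg unital Y) s"
proof -
  have "s 1 = 1" if unital
  proof -
    have one: "1 \<in> (free_alg unital X :: ('x, 'k) nc_poly set)"
        "1 \<in> (free_alg unital Y :: ('y, 'k) nc_poly set)"
      using that by (simp_all add: free_alg_closed)
    then obtain e where "e \<in> free_alg unital X" "s e = 1"
      using bij by (metis bij_betw_imp_surj_on imageE)
    then show ?thesis
      using mult[OF one(1), of e] by simp
  qed
  then show ?thesis
    using assms by (simp add: semi_iso_def)
qed

lemma bij_betw_scale:
  assumes "c \<noteq> 0"
  shows "bij_betw (scale c) (free_alg unital X) (free_alg unital X)"
  using assms by (intro bij_betwI[where g = "scale (1 / c)"]) (auto intro: free_alg_closed)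

lemma bij_betw_reversal: "bij_betw reversal (free_alg unital X) (free_alg unital X)"
  by (rule bij_betwI[where g = reversal]) (simp_all add: reversal_in_free_alg)

section \<open>Arrows and their values at the generators\<close>

definition free_hom :: "bool \<Rightarrow> 'x set \<Rightarrow> 'x set \<Rightarrow> ('x \<Rightarrow> ('x, 'k::field) nc_poly) \<Rightarrow> ('x, 'k) arrow"
    where
  "free_hom unital X Y f = Arrow X Y (restrict (subst f) (free_alg unital X))"

lemma free_hom_simps [simp]:
  "src (free_hom unital X Y f) = X" "trg (free_hom unital X Y f) = Y"
  "u \<in> free_alg unital X \<Longrightarrow> fn (free_hom unital X Y f) u = subst f u"
  by (simp_all add: free_hom_def)

lemma free_hom_Arr:
  assumes "finite X" "X \<subseteq> X0" "finite Y" "Y \<subseteq> X0" "f \<in> X \<rightarrow> free_alg unital Y"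
  shows "free_hom unital X Y f \<in> Arr (free_alg_cat unital X0)"
proof -
  have "alg_hom unital (free_alg unital X) (free_alg unital Y) (restrict (subst f) (free_alg unital
      X))"
    using alg_hom_subst[OF assms(5)] by (auto simp: alg_hom_def free_alg_closed)
  then show ?thesis
    using assms by (simp add: free_alg_cat_def free_hom_def)
qed

context
  fixes unital :: bool and X0 :: "'x set" and a :: "('x, 'k::field) arrow"
  assumes a: "a \<in> Arr (free_alg_cat unital X0)"
begin

lemma Arr_obj: "finite (src a)" "src a \<subseteq> X0" "finite (trg a)" "trg a \<subseteq> X0"
  using a by (simp_all add: free_alg_cat_def)

lemma Arr_hom: "alg_hom unital (free_alg unital (src a)) (free_alg unital (trg a)) (fn a)"
  using a by (simp add: free_alg_cat_def)

lemma Arr_in: "u \<in> free_alg unital (src a) \<Longrightarrow> fn a u \<in> free_alg unital (trg a)"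
  using Arr_hom by (auto simp: alg_hom_def)

lemma Arr_eq_subst: "u \<in> free_alg unital (src a) \<Longrightarrow> fn a u = subst (\<lambda>x. fn a (gen x)) u"
  using Arr_hom by (rule alg_hom_eq_subst)

lemma Arr_zero: "fn a 0 = 0"
  by (subst Arr_eq_subst) auto

lemma Arr_add: "u \<in> free_alg unital (src a) \<Longrightarrow> v \<in> free_alg unital (src a)
    \<Longrightarrow> fn a (u + v) = fn a u + fn a v"
  and Arr_mult: "u \<in> free_alg unital (src a) \<Longrightarrow> v \<in> free_alg unital (src a)
      \<Longrightarrow> fn a (u * v) = fn a u * fn a v"
  and Arr_scale: "u \<in> free_alg unital (src a) \<Longrightarrow> fn a (scale c u) = scale c (fn a u)"
  using Arr_hom by (simp_all add: alg_hom_def)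

lemma Arr_diff: "u \<in> free_alg unital (src a) \<Longrightarrow> v \<in> free_alg unital (src a)
    \<Longrightarrow> fn a (u - v) = fn a u - fn a v"
  using Arr_eq_subst[of "u - v"] Arr_eq_subst[of u] Arr_eq_subst[of v] diff_in_free_alg[of u unital
      "src a" v]
  by simp

end

lemma Arr_eqI:
  fixes a b :: "('x, 'k::field) arrow"
  assumes a: "a \<in> Arr (free_alg_cat unital X0)" and b: "b \<in> Arr (free_alg_cat unital X0)"
    and "src a = src b" "trg a = trg b" "\<And>x. x \<in> src a \<Longrightarrow> fn a (gen x) = fn b (gen x)"
  shows "a = b"
proof -
  have "fn a = fn b"
  proof
    fix u
    show "fn a u = fn b u"
    proof (cases "u \<in> free_alg unital (src a)")
      case True
      have "subst (\<lambda>x. fn a (gen x)) u = subst (\<lambda>x. fn b (gen x)) u"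
        using True assms(5) by (rule subst_cong)
      then show ?thesis
        using Arr_eq_subst[OF a, of u] Arr_eq_subst[OF b, of u] True assms(3) by simp
    next
      case False
      then show ?thesis
        using a b assms(3) by (simp add: free_alg_cat_def extensional_def)
    qed
  qed
  then show ?thesis
    using assms(3,4) by (cases a; cases b) simp
qed

lemma Obj_iff: "X \<in> Obj (free_alg_cat unital X0) \<longleftrightarrow> finite X \<and> X \<subseteq> X0"
  by (simp add: free_alg_cat_def)

lemma cat_simps [simp]:
  "Dom (free_alg_cat unital X0) = src" "Cod (free_alg_cat unital X0) = trg"
  by (simp_all add: free_alg_cat_def)

lemma fn_Comp [simp]:
  "u \<in> free_alg unital (src f) \<Longrightarrow> fn (Comp (free_alg_cat unital X0) g f) u = fn g (fn f u)"
  by (simp add: free_alg_cat_def compose_def)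

lemma src_trg_Comp [simp]:
  "src (Comp (free_alg_cat unital X0) g f) = src f"
      "trg (Comp (free_alg_cat unital X0) g f) = trg g"
  by (simp_all add: free_alg_cat_def)

lemma fn_Id [simp]: "u \<in> free_alg unital X \<Longrightarrow> fn (Id (free_alg_cat unital X0) X) u = u"
  by (simp add: free_alg_cat_def)

lemma src_trg_Id [simp]:
  "src (Id (free_alg_cat unital X0) X) = X" "trg (Id (free_alg_cat unital X0) X) = X"
  by (simp_all add: free_alg_cat_def)

lemma Id_Arr: "finite X \<Longrightarrow> X \<subseteq> X0 \<Longrightarrow> Id (free_alg_cat unital X0) X \<in> Arr (free_alg_cat unital X0)"
  by (rule category.Id_Arr[OF category_free_alg_cat]) (simp add: Obj_iff)

lemma Comp_Arr:
  "f \<in> Arr (free_alg_cat unital X0) \<Longrightarrow> g \<in> Arr (free_alg_cat unital X0) \<Longrightarrow> trg f = src g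
    \<Longrightarrow> Comp (free_alg_cat unital X0) g f \<in> Arr (free_alg_cat unital X0)"
  by (rule category.Comp_Arr[OF category_free_alg_cat]) simp_all

section \<open>The action of an automorphism on objects and elements\<close>

locale free_alg_cat_automorphism =
  fixes unital :: bool and X0 :: "'x set" and F :: "('x, 'k::field) free_alg_cat_map"
  assumes infinite_X0: "infinite X0" and F: "F \<in> cat_automorphisms (free_alg_cat unital X0)"
begin

abbreviation \<A> :: "('x set, ('x, 'k) arrow) category" where
  "\<A> \<equiv> free_alg_cat unital X0"

abbreviation A :: "'x set \<Rightarrow> ('x, 'k) nc_poly set" where
  "A \<equiv> free_alg unital"

abbreviation \<phi> :: "'x set \<Rightarrow> 'x set" where
  "\<phi> \<equiv> fst F"

abbreviation \<Phi> :: "('x, 'k) arrow \<Rightarrow> ('x, 'k) arrow" where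
  "\<Phi> \<equiv> snd F"

lemma F_functor: "is_functor \<A> \<A> F"
  and bij_\<phi>: "bij_betw \<phi> (Obj \<A>) (Obj \<A>)"
  and bij_\<Phi>: "bij_betw \<Phi> (Arr \<A>) (Arr \<A>)"
  using F by (simp_all add: cat_automorphisms_def)

lemma \<phi>_obj:
  assumes "finite X" "X \<subseteq> X0"
  shows "finite (\<phi> X)" "\<phi> X \<subseteq> X0"
proof -
  have "\<phi> X \<in> Obj \<A>"
    using F_functor assms unfolding is_functor_def by (simp add: Obj_iff)
  then show "finite (\<phi> X)" "\<phi> X \<subseteq> X0"
    by (simp_all add: Obj_iff)
qed

lemma \<phi>_inj: "finite X \<Longrightarrow> X \<subseteq> X0 \<Longrightarrow> finite Y \<Longrightarrow> Y \<subseteq> X0 \<Longrightarrow> \<phi> X = \<phi> Y \<Longrightarrow> X = Y"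
  by (rule inj_onD[OF bij_betw_imp_inj_on[OF bij_\<phi>]]) (simp_all add: Obj_iff)

lemma \<phi>_surj:
  assumes "finite X" "X \<subseteq> X0"
  obtains Y where "finite Y" "Y \<subseteq> X0" "\<phi> Y = X"
proof -
  have "X \<in> \<phi> ` Obj \<A>"
    using assms by (simp only: bij_betw_imp_surj_on[OF bij_\<phi>] Obj_iff)
  then obtain Y where "X = \<phi> Y" "Y \<in> Obj \<A>"
    by (rule imageE)
  then show thesis
    using that[of Y] by (simp add: Obj_iff)
qed

lemma \<Phi>_Arr:
  assumes "a \<in> Arr \<A>"
  shows "\<Phi> a \<in> Arr \<A>" "src (\<Phi> a) = \<phi> (src a)" "trg (\<Phi> a) = \<phi> (trg a)"
proof -
  have "\<Phi> a \<in> Arr \<A> \<and> src (\<Phi> a) = \<phi> (src a) \<and> trg (\<Phi> a) = \<phi> (trg a)"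
    using F_functor unfolding is_functor_def cat_simps
    by (elim conjE) (erule bspec[OF _ assms])
  then show "\<Phi> a \<in> Arr \<A>" "src (\<Phi> a) = \<phi> (src a)" "trg (\<Phi> a) = \<phi> (trg a)"
    by simp_all
qed

lemma \<Phi>_Comp:
  assumes "a \<in> Arr \<A>" "b \<in> Arr \<A>" "trg a = src b"
  shows "\<Phi> (Comp \<A> b a) = Comp \<A> (\<Phi> b) (\<Phi> a)"
  using F_functor assms(3) unfolding is_functor_def cat_simps
  by (elim conjE) (drule bspec[OF _ assms(1)], drule bspec[OF _ assms(2)], erule mp)

lemma \<Phi>_Id:
  assumes "finite X" "X \<subseteq> X0"
  shows "\<Phi> (Id \<A> X) = Id \<A> (\<phi> X)"
proof -
  have "X \<in> Obj \<A>"
    using assms by (simp add: Obj_iff)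
  then show ?thesis
    using F_functor unfolding is_functor_def by (elim conjE) (erule bspec)
qed

lemma \<Phi>_inj: "a \<in> Arr \<A> \<Longrightarrow> b \<in> Arr \<A> \<Longrightarrow> \<Phi> a = \<Phi> b \<Longrightarrow> a = b"
  by (rule inj_onD[OF bij_betw_imp_inj_on[OF bij_\<Phi>]])

text \<open>A preimage of \<open>b\<close> exists since \<open>\<Phi>\<close> is onto; its source
  and target are the expected ones because \<open>\<phi>\<close> is injective on objects.\<close>

lemma \<Phi>_full:
  assumes "finite X" "X \<subseteq> X0" "finite Y" "Y \<subseteq> X0" "b \<in> Arr \<A>" "src b = \<phi> X" "trg b = \<phi> Y"
  obtains a where "a \<in> Arr \<A>" "src a = X" "trg a = Y" "\<Phi> a = b"
proof -
  have "b \<in> \<Phi> ` Arr \<A>"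
    using assms(5) by (simp only: bij_betw_imp_surj_on[OF bij_\<Phi>])
  then obtain a where a: "a \<in> Arr \<A>" "\<Phi> a = b"
    by (metis imageE)
  have "src a = X" "trg a = Y"
    using \<Phi>_Arr[OF a(1)] a(2) assms Arr_obj[OF a(1)] \<phi>_inj by metis+
  then show thesis
    using that a by blast
qed

text \<open>The algebra on the empty set has only one endomorphism, whereas any generator lets the
  zero substitution differ from the identity.\<close>

lemma \<phi>_empty: "\<phi> {} = {}"
proof (rule ccontr)
  assume "\<phi> {} \<noteq> {}"
  then obtain y where y: "y \<in> \<phi> {}"
    by auto
  have obj: "finite (\<phi> {})" "\<phi> {} \<subseteq> X0"
    by (simp_all add: \<phi>_obj)
  define b where "b = free_hom unital (\<phi> {}) (\<phi> {}) (\<lambda>_. 0 :: ('x, 'k) nc_poly)"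
  have b: "b \<in> Arr \<A>" and i: "Id \<A> (\<phi> {}) \<in> Arr \<A>"
    using obj unfolding b_def by (auto intro: free_hom_Arr Id_Arr)
  obtain a where a: "a \<in> Arr \<A>" "src a = {}" "trg a = {}" "\<Phi> a = b"
    using \<Phi>_full[of "{}" "{}" b] b by (auto simp: b_def)
  obtain a' where a': "a' \<in> Arr \<A>" "src a' = {}" "trg a' = {}" "\<Phi> a' = Id \<A> (\<phi> {})"
    using \<Phi>_full[of "{}" "{}" "Id \<A> (\<phi> {})"] i by auto
  \<comment> \<open>There are no generators on which the two arrows could differ.\<close>
  have "a = a'"
    using Arr_eqI[OF a(1) a'(1)] a a' by simp
  then have "fn b (gen y) = fn (Id \<A> (\<phi> {})) (gen y)"
    using a a' by simp
  then show False
    using y by (simp add: b_def free_alg_closed)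
qed

text \<open>
  A singleton is a retract of every nonempty set, so its image is nonempty and embeds into a
  commutative algebra.
\<close>

lemma \<phi>_singleton:
  assumes x0: "x0 \<in> X0"
  obtains x1 where "x1 \<in> X0" "\<phi> {x0} = {x1}"
proof -
  have X: "finite {x0}" "{x0} \<subseteq> X0"
    using x0 by auto
  have ne: "\<phi> {x0} \<noteq> {}"
    using \<phi>_inj[of "{x0}" "{}"] X \<phi>_empty by auto
  obtain Y where Y: "finite Y" "Y \<subseteq> X0" "\<phi> Y = {x0}"
    using \<phi>_surj[OF X] .
  then obtain y where y: "y \<in> Y"
    using \<phi>_empty by fastforce
  \<comment> \<open>The retraction is placed on the preimage \<open>Y\<close> of
    \<open>{x0}\<close>, so that \<open>\<Phi> i\<close> maps injectively into the commutative
    algebra \<open>A {x0}\<close>.\<close>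
  define i where "i = free_hom unital {x0} Y (\<lambda>_. gen y :: ('x, 'k) nc_poly)"
  define r where "r = free_hom unital Y {x0} (\<lambda>_. gen x0 :: ('x, 'k) nc_poly)"
  have i: "i \<in> Arr \<A>" "src i = {x0}" "trg i = Y" and r: "r \<in> Arr \<A>" "src r = Y" "trg r = {x0}"
    using X Y y unfolding i_def r_def by (auto intro!: free_hom_Arr free_alg_closed)
  have "Comp \<A> r i = Id \<A> {x0}"
    using i r X y
    by (intro Arr_eqI[of _ unital X0] Comp_Arr Id_Arr) (auto simp: i_def r_def free_alg_closed)
  then have "Comp \<A> (\<Phi> r) (\<Phi> i) = Id \<A> (\<phi> {x0})"
    using \<Phi>_Comp[OF i(1) r(1)] i r X by (simp add: \<Phi>_Id)
  then have ri: "fn (\<Phi> r) (fn (\<Phi> i) u) = u" if "u \<in> A (\<phi> {x0})" for u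
    using that fn_Comp[of u unital "\<Phi> i" X0 "\<Phi> r"] i by (simp add: \<Phi>_Arr)
  note i' = \<Phi>_Arr[OF i(1)]
  have "p = q" if "p \<in> \<phi> {x0}" "q \<in> \<phi> {x0}" for p q
  proof -
    have g: "gen p \<in> A (\<phi> {x0})" "gen q \<in> A (\<phi> {x0})"
      using that by (simp_all add: free_alg_closed)
    then have "fn (\<Phi> i) (gen p) \<in> A {x0}" "fn (\<Phi> i) (gen q) \<in> A {x0}"
      using Arr_in[OF i'(1)] i' i Y by auto
    then have "fn (\<Phi> i) (gen p * gen q) = fn (\<Phi> i) (gen q * gen p)"
      using g i i' by (simp add: Arr_mult[OF i'(1)] mult_commute_free_alg_singleton)
    then have "gen p * gen q = (gen q * gen p :: ('x, 'k) nc_poly)"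
      using ri g free_alg_closed(2) by metis
    then show ?thesis
      by (simp add: gen_mult_commute_iff)
  qed
  then obtain x1 where "\<phi> {x0} = {x1}"
    using ne by blast
  then show thesis
    using that \<phi>_obj(2)[OF X] by auto
qed

text \<open>An element \<open>u\<close> is encoded as the arrow \<open>x0 \<mapsto> u\<close>, and
  its transported arrow is decoded at the generator \<open>x1\<close> of the image of
  \<open>{x0}\<close>. Composition of arrows then becomes application to elements.\<close>

lemma ex_equivariant_family:
  obtains s where
    "\<And>X. finite X \<Longrightarrow> X \<subseteq> X0 \<Longrightarrow> bij_betw (s X) (A X) (A (\<phi> X))"
    "\<And>X. s X 0 = 0"
    "\<And>a u. a \<in> Arr \<A> \<Longrightarrow> u \<in> A (src a) \<Longrightarrow> fn (\<Phi> a) (s (src a) u) = s (trg a) (fn a u)"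
proof -
  obtain x0 where x0: "x0 \<in> X0"
    using infinite_X0 by fastforce
  obtain x1 where x1: "x1 \<in> X0" "\<phi> {x0} = {x1}"
    using \<phi>_singleton[OF x0] .
  define \<alpha> :: "'x set \<Rightarrow> ('x, 'k) nc_poly \<Rightarrow> ('x, 'k) arrow"
    where "\<alpha> X u = free_hom unital {x0} X (\<lambda>_. u)" for X u
  \<comment> \<open>The second term normalises \<open>s X 0\<close> to 0; equivariance survives
    because the maps \<open>fn (\<Phi> a)\<close> are additive.\<close>
  define s where "s X u = fn (\<Phi> (\<alpha> X u)) (gen x1) - fn (\<Phi> (\<alpha> X 0)) (gen x1)" for X u
  have g: "gen x0 \<in> A {x0}" "gen x1 \<in> A {x1}"
    by (simp_all add: free_alg_closed)
  have \<alpha>: "\<alpha> X u \<in> Arr \<A>" "src (\<alpha> X u) = {x0}" "trg (\<alpha> X u) = X" "fn (\<alpha> X u) (gen x0) = u"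
    if "finite X" "X \<subseteq> X0" "u \<in> A X" for X u
    using that x0 g unfolding \<alpha>_def by (auto intro: free_hom_Arr)
  have \<Phi>\<alpha>: "\<Phi> (\<alpha> X u) \<in> Arr \<A>" "src (\<Phi> (\<alpha> X u)) = {x1}" "trg (\<Phi> (\<alpha> X u)) = \<phi> X"
    "fn (\<Phi> (\<alpha> X u)) (gen x1) \<in> A (\<phi> X)"
    if "finite X" "X \<subseteq> X0" "u \<in> A X" for X u
  proof -
    show *: "\<Phi> (\<alpha> X u) \<in> Arr \<A>" "src (\<Phi> (\<alpha> X u)) = {x1}" "trg (\<Phi> (\<alpha> X u)) = \<phi> X"
      using \<Phi>_Arr[OF \<alpha>(1)[OF that]] \<alpha>[OF that] x1 by simp_all
    show "fn (\<Phi> (\<alpha> X u)) (gen x1) \<in> A (\<phi> X)"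
      using Arr_in[OF *(1)] * g by simp
  qed
  show thesis
  proof (rule that)
    fix X assume X: "finite X" "X \<subseteq> X0"
    have "inj_on (s X) (A X)"
    proof (rule inj_onI)
      fix u v assume uv: "u \<in> A X" "v \<in> A X" "s X u = s X v"
      have "fn (\<Phi> (\<alpha> X u)) (gen x1) = fn (\<Phi> (\<alpha> X v)) (gen x1)"
        using uv(3) unfolding s_def by simp
      then have "\<Phi> (\<alpha> X u) = \<Phi> (\<alpha> X v)"
        using \<Phi>\<alpha>(2,3)[OF X uv(1)] \<Phi>\<alpha>(2,3)[OF X uv(2)]
        by (intro Arr_eqI[OF \<Phi>\<alpha>(1)[OF X uv(1)] \<Phi>\<alpha>(1)[OF X uv(2)]]) simp_all
      then have "\<alpha> X u = \<alpha> X v"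
        by (rule \<Phi>_inj[OF \<alpha>(1)[OF X uv(1)] \<alpha>(1)[OF X uv(2)]])
      then have "fn (\<alpha> X u) (gen x0) = fn (\<alpha> X v) (gen x0)"
        by (rule arg_cong)
      then show "u = v"
        by (simp only: \<alpha>(4)[OF X uv(1)] \<alpha>(4)[OF X uv(2)])
    qed
    moreover have "s X u \<in> A (\<phi> X)" if "u \<in> A X" for u
      using diff_in_free_alg[OF \<Phi>\<alpha>(4)[OF X that] \<Phi>\<alpha>(4)[OF X zero_in_free_alg]]
      by (simp only: s_def)
    moreover have "w \<in> s X ` A X" if "w \<in> A (\<phi> X)" for w
    proof -
      \<comment> \<open>The offset is put back, and fullness provides an arrow out of
        \<open>{x0}\<close> whose image sends \<open>x1\<close> to \<open>w'\<close>.\<close>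
      define w' where "w' = w + fn (\<Phi> (\<alpha> X 0)) (gen x1)"
      have w': "w' \<in> A (\<phi> X)"
        using free_alg_closed(1)[OF that \<Phi>\<alpha>(4)[OF X zero_in_free_alg]] by (simp only: w'_def)
      have "free_hom unital {x1} (\<phi> X) (\<lambda>_. w') \<in> Arr \<A>"
        using X x1 w' \<phi>_obj by (intro free_hom_Arr) auto
      then obtain a where a: "a \<in> Arr \<A>" "src a = {x0}" "trg a = X"
          "\<Phi> a = free_hom unital {x1} (\<phi> X) (\<lambda>_. w')"
        using \<Phi>_full[of "{x0}" X "free_hom unital {x1} (\<phi> X) (\<lambda>_. w')"] X x0 x1 by auto
      have u: "fn a (gen x0) \<in> A X"
        using Arr_in[OF a(1)] a g by simp
      have "a = \<alpha> X (fn a (gen x0))"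
        using X a u by (intro Arr_eqI[of _ unital X0]) (auto simp: \<alpha>)
      then have "\<Phi> (\<alpha> X (fn a (gen x0))) = free_hom unital {x1} (\<phi> X) (\<lambda>_. w')"
        using a by metis
      then have "s X (fn a (gen x0)) = w"
        using g by (simp add: s_def w'_def)
      then show ?thesis
        using u by blast
    qed
    ultimately show "bij_betw (s X) (A X) (A (\<phi> X))"
      by (auto simp: bij_betw_def)
  next
    show "s X 0 = 0" for X
      by (simp add: s_def)
  next
    fix a u assume a: "a \<in> Arr \<A>" and u: "u \<in> A (src a)"
    note o = Arr_obj[OF a]
    have c: "fn (\<Phi> a) (fn (\<Phi> (\<alpha> (src a) v)) (gen x1)) = fn (\<Phi> (\<alpha> (trg a) (fn a v))) (gen x1)"
      if v: "v \<in> A (src a)" for v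
    proof -
      have "Comp \<A> a (\<alpha> (src a) v) = \<alpha> (trg a) (fn a v)"
        using a v o g Arr_in[OF a v]
        by (intro Arr_eqI[of _ unital X0] Comp_Arr) (auto simp: \<alpha>)
      then have "\<Phi> (\<alpha> (trg a) (fn a v)) = Comp \<A> (\<Phi> a) (\<Phi> (\<alpha> (src a) v))"
        using \<Phi>_Comp[of "\<alpha> (src a) v" a] a v o by (simp add: \<alpha>)
      then show ?thesis
        using v o g by (simp add: \<Phi>\<alpha>)
    qed
    show "fn (\<Phi> a) (s (src a) u) = s (trg a) (fn a u)"
      using u o c[OF u] c[of 0]
      by (simp add: s_def Arr_diff[OF \<Phi>_Arr(1)[OF a]] \<Phi>_Arr[OF a] \<Phi>\<alpha> Arr_zero[OF a])
  qed
qed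

section \<open>From transported elements to the ring structure\<close>

context
  fixes s :: "'x set \<Rightarrow> ('x, 'k) nc_poly \<Rightarrow> ('x, 'k) nc_poly"
  assumes s_bij: "\<And>X. finite X \<Longrightarrow> X \<subseteq> X0 \<Longrightarrow> bij_betw (s X) (A X) (A (\<phi> X))"
    and s_zero: "\<And>X. s X 0 = 0"
    and s_Arr: "\<And>a u. a \<in> Arr \<A> \<Longrightarrow> u \<in> A (src a) \<Longrightarrow> fn (\<Phi> a) (s (src a) u) = s (trg a) (fn a u)"
begin

lemma s_in: "finite X \<Longrightarrow> X \<subseteq> X0 \<Longrightarrow> u \<in> A X \<Longrightarrow> s X u \<in> A (\<phi> X)"
  using bij_betwE[OF s_bij] by blast

text \<open>
  Since \<open>\<Phi>\<close> is full and faithful, homomorphisms out of \<open>A(\<phi> X)\<close> correspond to arbitrary values at the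
  elements \<open>s X (gen x)\<close>; hence these are free generators of \<open>A(\<phi> X)\<close>.
\<close>

lemma ex_inverse_on_generators:
  assumes X: "finite X" "X \<subseteq> X0"
  obtains g where "g \<in> \<phi> X \<rightarrow> A X" "\<And>x. x \<in> X \<Longrightarrow> subst g (s X (gen x)) = gen x"
    "\<And>y. y \<in> \<phi> X \<Longrightarrow> subst (\<lambda>x. s X (gen x)) (g y) = gen y"
proof -
  note oX = \<phi>_obj[OF X]
  have sg: "s X (gen x) \<in> A (\<phi> X)" if "x \<in> X" for x
    using that by (intro s_in X free_alg_closed)
  obtain Z where Z: "finite Z" "Z \<subseteq> X0" "\<phi> Z = X"
    using \<phi>_surj[OF X] .
  have bZ: "bij_betw (s Z) (A Z) (A X)"
    using s_bij[OF Z(1,2)] Z(3) by simp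
  \<comment> \<open>The elements \<open>h x\<close> are chosen in \<open>A Z\<close> over the
    generators of \<open>A X\<close>, where \<open>\<phi> Z = X\<close>; by equivariance the image
    of \<open>x \<mapsto> h x\<close> sends \<open>s X (gen x)\<close> to
    \<open>gen x\<close>.\<close>
  define h where "h x = inv_into (A Z) (s Z) (gen x)" for x
  have h: "h x \<in> A Z" "s Z (h x) = gen x" if "x \<in> X" for x
  proof -
    have g: "gen x \<in> A X"
      using that by (rule free_alg_closed)
    show "h x \<in> A Z"
      unfolding h_def by (rule bij_betwE[OF bij_betw_inv_into[OF bZ], rule_format, OF g])
    show "s Z (h x) = gen x"
      unfolding h_def by (rule bij_betw_inv_into_right[OF bZ g])
  qed
  define a where "a = free_hom unital X Z h"
  have a: "a \<in> Arr \<A>" "src a = X" "trg a = Z"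
    unfolding a_def using h X Z by (auto intro!: free_hom_Arr)
  have a': "\<Phi> a \<in> Arr \<A>" "src (\<Phi> a) = \<phi> X" "trg (\<Phi> a) = X"
    using \<Phi>_Arr[OF a(1)] a Z by auto
  have as: "fn (\<Phi> a) (s X (gen x)) = gen x" if "x \<in> X" for x
    using s_Arr[OF a(1), of "gen x"] a h(2)[OF that] that by (simp add: free_alg_closed a_def)
  define b where "b = free_hom unital X (\<phi> X) (\<lambda>x. s X (gen x))"
  have b: "b \<in> Arr \<A>" "src b = X" "trg b = \<phi> X"
    unfolding b_def using sg X oX by (auto intro!: free_hom_Arr)
  have c: "Comp \<A> b (\<Phi> a) \<in> Arr \<A>" "src (Comp \<A> b (\<Phi> a)) = \<phi> X" "trg (Comp \<A> b (\<Phi> a)) = \<phi> X"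
    using Comp_Arr[OF a'(1) b(1)] a' b by simp_all
  \<comment> \<open>The composite is the image of some endomorphism \<open>e\<close> of
    \<open>A X\<close>. It fixes each \<open>s X (gen x)\<close>, so by injectivity of
    \<open>s X\<close> the arrow \<open>e\<close> fixes the generators.\<close>
  obtain e where e: "e \<in> Arr \<A>" "src e = X" "trg e = X" "\<Phi> e = Comp \<A> b (\<Phi> a)"
    using \<Phi>_full[OF X X c] .
  have "e = Id \<A> X"
  proof (rule Arr_eqI[OF e(1) Id_Arr[OF X]])
    fix x assume "x \<in> src e"
    then have x: "x \<in> X" and g: "gen x \<in> A X"
      using e by (auto intro: free_alg_closed)
    have "s X (fn e (gen x)) = fn (\<Phi> e) (s X (gen x))"
      using s_Arr[OF e(1), of "gen x"] e g by simp
    also have "\<dots> = fn b (gen x)"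
      using e a' sg[OF x] as[OF x] by simp
    also have "\<dots> = s X (gen x)"
      using g by (simp add: b_def)
    finally have "fn e (gen x) = gen x"
      using s_bij[OF X] Arr_in[OF e(1), of "gen x"] e g by (metis bij_betw_inv_into_left)
    then show "fn e (gen x) = fn (Id \<A> X) (gen x)"
      using g by simp
  qed (use e in simp_all)
  then have ba: "Comp \<A> b (\<Phi> a) = Id \<A> (\<phi> X)"
    using e(4) \<Phi>_Id[OF X] by simp
  show thesis
  proof (rule that)
    have gy: "gen y \<in> A (\<phi> X)" if "y \<in> \<phi> X" for y
      using that by (rule free_alg_closed)
    show "(\<lambda>y. fn (\<Phi> a) (gen y)) \<in> \<phi> X \<rightarrow> A X"
      using Arr_in[OF a'(1)] a' gy by auto
    show "subst (\<lambda>y. fn (\<Phi> a) (gen y)) (s X (gen x)) = gen x" if "x \<in> X" for x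
      using Arr_eq_subst[OF a'(1), of "s X (gen x)"] sg[OF that] as[OF that] a' by simp
    show "subst (\<lambda>x. s X (gen x)) (fn (\<Phi> a) (gen y)) = gen y" if "y \<in> \<phi> X" for y
    proof -
      have "fn b (fn (\<Phi> a) (gen y)) = fn (Comp \<A> b (\<Phi> a)) (gen y)"
        using gy[OF that] a' by simp
      also have "\<dots> = gen y"
        using gy[OF that] by (simp add: ba)
      finally show ?thesis
        using Arr_in[OF a'(1), of "gen y"] gy[OF that] a' by (simp add: b_def)
    qed
  qed
qed

text \<open>Composing \<open>s X\<close> with the isomorphism that takes each
  \<open>s X (gen x)\<close> to \<open>gen x\<close> makes the generators fixed. The second clause
  recovers \<open>s\<close> from the corrected family.\<close>

lemma ex_conjugating_family:
  obtains g where "conjugating_family unital X0 (\<lambda>X u. subst (g X) (s X u))"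
    and "\<And>X u. finite X \<Longrightarrow> X \<subseteq> X0 \<Longrightarrow> u \<in> A X
      \<Longrightarrow> s X u = subst (\<lambda>x. s X (gen x)) (subst (g X) (s X u))"
proof -
  define good where "good X g \<longleftrightarrow> g \<in> \<phi> X \<rightarrow> A X \<and> (\<forall>x\<in>X. subst g (s X (gen x)) = gen x) \<and>
    (\<forall>y\<in>\<phi> X. subst (\<lambda>x. s X (gen x)) (g y) = gen y)" for X g
  define g where "g X = (SOME g. good X g)" for X
  have good: "good X (g X)" if X: "finite X" "X \<subseteq> X0" for X
  proof -
    obtain h where "good X h"
      using ex_inverse_on_generators[OF X] unfolding good_def by metis
    then show ?thesis
      unfolding g_def by (rule someI[of "good X"])
  qed
  define t where "t X u = subst (g X) (s X u)" for X u
  have g: "g X \<in> \<phi> X \<rightarrow> A X" "\<And>x. x \<in> X \<Longrightarrow> subst (g X) (s X (gen x)) = gen x"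
    "\<And>y. y \<in> \<phi> X \<Longrightarrow> subst (\<lambda>x. s X (gen x)) (g X y) = gen y" if "finite X" "X \<subseteq> X0" for X
    using good[OF that] by (auto simp: good_def)
  have sg: "s X (gen x) \<in> A (\<phi> X)" if "finite X" "X \<subseteq> X0" "x \<in> X" for X x
    using that by (intro s_in free_alg_closed)
  have gs: "subst (g X) (subst (\<lambda>x. s X (gen x)) u) = u" if "finite X" "X \<subseteq> X0" "u \<in> A X" for X u
  proof -
    have "subst (g X) (subst (\<lambda>x. s X (gen x)) u) = subst gen u"
      unfolding subst_subst using g(2)[OF that(1,2)] by (intro subst_cong[OF that(3)])
    then show ?thesis by simp
  qed
  have sgi: "subst (\<lambda>x. s X (gen x)) (subst (g X) w) = w"
      if "finite X" "X \<subseteq> X0" "w \<in> A (\<phi> X)" for X w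
  proof -
    have "subst (\<lambda>x. s X (gen x)) (subst (g X) w) = subst gen w"
      unfolding subst_subst using g(3)[OF that(1,2)] by (intro subst_cong[OF that(3)])
    then show ?thesis by simp
  qed
  have bij: "bij_betw (t X) (A X) (A X)" if X: "finite X" "X \<subseteq> X0" for X
  proof -
    have "bij_betw (subst (g X)) (A (\<phi> X)) (A X)"
    proof (rule bij_betwI[where g = "subst (\<lambda>x. s X (gen x))"])
      show "subst (g X) \<in> A (\<phi> X) \<rightarrow> A X"
        using g(1)[OF X] by (auto intro: subst_in_free_alg)
      show "subst (\<lambda>x. s X (gen x)) \<in> A X \<rightarrow> A (\<phi> X)"
        using sg[OF X] by (auto intro!: subst_in_free_alg)
    qed (use gs sgi X in auto)
    then have "bij_betw (subst (g X) \<circ> s X) (A X) (A X)"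
      by (rule bij_betw_trans[OF s_bij[OF X]])
    then show ?thesis
      by (simp add: t_def[abs_def] comp_def)
  qed
  show thesis
  proof (rule that)
    show "s X u = subst (\<lambda>x. s X (gen x)) (subst (g X) (s X u))"
        if "finite X" "X \<subseteq> X0" "u \<in> A X" for X u
      using sgi[OF that(1,2) s_in[OF that]] by simp
    have "conjugating_family unital X0 t"
    proof
      fix X assume X: "finite X" "X \<subseteq> X0"
      show "bij_betw (t X) (A X) (A X)"
        using X by (rule bij)
      show "t X (gen x) = gen x" if "x \<in> X" for x
        using g(2)[OF X that] by (simp add: t_def)
      show "t X 0 = 0"
        by (simp add: t_def s_zero)
      fix Y and f :: "'x \<Rightarrow> ('x, 'k) nc_poly" and u :: "('x, 'k) nc_poly"
      assume Y: "finite Y" "Y \<subseteq> X0" and f: "f \<in> X \<rightarrow> A Y" and u: "u \<in> A X"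
      define a where "a = free_hom unital X Y f"
      have a: "a \<in> Arr \<A>" "src a = X" "trg a = Y"
        unfolding a_def using f X Y by (auto intro: free_hom_Arr)
      have a': "\<Phi> a \<in> Arr \<A>" "src (\<Phi> a) = \<phi> X" "trg (\<Phi> a) = \<phi> Y"
        using \<Phi>_Arr[OF a(1)] a by auto
      let ?h = "\<lambda>y. fn (\<Phi> a) (gen y)"
      have nat: "subst ?h (s X v) = s Y (fn a v)" if "v \<in> A X" for v
        using s_Arr[OF a(1), of v] Arr_eq_subst[OF a'(1), of "s X v"] s_in[OF X that] that a a'
            by simp
      have tu: "t X u \<in> A X"
        using bij[OF X] u by (rule bij_betw_apply)
      \<comment> \<open>\<open>s X u\<close> is rewritten as a substitution into
        \<open>t X u\<close>; the homomorphisms \<open>\<Phi> a\<close> and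
        \<open>subst (g Y)\<close> then act on the substituted values only.\<close>
      have "t Y (subst f u) = subst (g Y) (subst ?h (s X u))"
        using nat[OF u] u by (simp add: t_def a_def)
      also have "s X u = subst (\<lambda>x. s X (gen x)) (t X u)"
        using sgi[OF X s_in[OF X u]] by (simp add: t_def)
      also have "subst (g Y) (subst ?h (subst (\<lambda>x. s X (gen x)) (t X u)))
          = subst (\<lambda>x. subst (g Y) (subst ?h (s X (gen x)))) (t X u)"
        by (simp only: subst_subst)
      also have "\<dots> = subst (\<lambda>x. t Y (f x)) (t X u)"
        using nat by (intro subst_cong[OF tu]) (simp add: t_def a_def free_alg_closed)
      finally show "t Y (subst f u) = subst (\<lambda>x. t Y (f x)) (t X u)" .
    qed (rule infinite_X0)
    then show "conjugating_family unital X0 (\<lambda>X u. subst (g X) (s X u))"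
      by (simp add: t_def[abs_def])
  qed
qed

text \<open>\<open>s X\<close> is the corrected family followed by an algebra homomorphism, so the
  laws of that family carry over with the same \<open>d\<close> and \<open>c\<close>.\<close>

lemma s_ring_structure:
  obtains d c where "field_aut d" "c \<noteq> 0"
    "\<And>X u v. finite X \<Longrightarrow> X \<subseteq> X0 \<Longrightarrow> u \<in> A X \<Longrightarrow> v \<in> A X \<Longrightarrow> s X (u + v) = s X u + s X v"
    "\<And>X u a. finite X \<Longrightarrow> X \<subseteq> X0 \<Longrightarrow> u \<in> A X \<Longrightarrow> s X (scale a u) = scale (d a) (s X u)"
    "(\<forall>X u v. finite X \<longrightarrow> X \<subseteq> X0 \<longrightarrow> u \<in> A X \<longrightarrow> v \<in> A X \<longrightarrow> s X (u * v) = scale c (s X u * s X v)) \<or>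
     (\<forall>X u v. finite X \<longrightarrow> X \<subseteq> X0 \<longrightarrow> u \<in> A X \<longrightarrow> v \<in> A X \<longrightarrow> s X (u * v) = scale c (s X v * s X u))"
proof -
  obtain g where "conjugating_family unital X0 (\<lambda>X u. subst (g X) (s X u))"
    and st: "\<And>X u. finite X \<Longrightarrow> X \<subseteq> X0 \<Longrightarrow> u \<in> A X
      \<Longrightarrow> s X u = subst (\<lambda>x. s X (gen x)) (subst (g X) (s X u))"
    using ex_conjugating_family by blast
  then interpret t: conjugating_family unital X0 "\<lambda>X u. subst (g X) (s X u)"
    by simp
  have add: "s X (u + v) = s X u + s X v" if "finite X" "X \<subseteq> X0" "u \<in> A X" "v \<in> A X" for X u v
    by (subst (1 2 3) st) (simp_all add: that free_alg_closed t.t_add)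
  have scale: "s X (scale a u) = scale (t.\<rho> a) (s X u)" if "finite X" "X \<subseteq> X0" "u \<in> A X" for X u a
    by (subst (1 2) st) (simp_all add: that free_alg_closed t.t_scale)
  show thesis
  proof (cases rule: t.t_mult)
    case (1 c)
    have "s X (u * v) = scale c (s X u * s X v)"
        if "finite X" "X \<subseteq> X0" "u \<in> A X" "v \<in> A X" for X u v
      by (subst (1 2 3) st) (simp_all add: that free_alg_closed 1)
    then show thesis
      using that[OF t.field_aut_\<rho> 1(1) add scale] by blast
  next
    case (2 c)
    have "s X (u * v) = scale c (s X v * s X u)"
        if "finite X" "X \<subseteq> X0" "u \<in> A X" "v \<in> A X" for X u v
      by (subst (1 2 3) st) (simp_all add: that free_alg_closed 2)
    then show thesis
      using that[OF t.field_aut_\<rho> 2(1) add scale] by blast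
  qed
qed

end

end

section \<open>Mirror automorphisms\<close>

text \<open>Mirroring is written as conjugation by reversal, which gives the values at all elements;
  at generators the inner reversal disappears.\<close>

definition mirror_arrow :: "bool \<Rightarrow> ('x, 'k::field) arrow \<Rightarrow> ('x, 'k) arrow" where
  "mirror_arrow unital f = Arrow (src f) (trg f) (\<lambda>u\<in>free_alg unital (src f). reversal (fn f
      (reversal u)))"

lemma mirror_arrow_simps [simp]:
  "src (mirror_arrow unital f) = src f" "trg (mirror_arrow unital f) = trg f"
  "u \<in> free_alg unital (src f) \<Longrightarrow> fn (mirror_arrow unital f) u = reversal (fn f (reversal u))"
  by (simp_all add: mirror_arrow_def)

text \<open>Each reversal exchanges the factors of a product, so the two together preserve their
  order.\<close>

lemma mirror_arrow_Arr:
  fixes f :: "('x, 'k::field) arrow"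
  assumes f: "f \<in> Arr (free_alg_cat unital X0)"
  shows "mirror_arrow unital f \<in> Arr (free_alg_cat unital X0)"
proof -
  note r = reversal_in_free_alg
  have "alg_hom unital (free_alg unital (src f)) (free_alg unital (trg f)) (fn (mirror_arrow unital
      f))"
    unfolding alg_hom_def
  proof (intro conjI ballI allI impI)
    show "fn (mirror_arrow unital f) \<in> free_alg unital (src f) \<rightarrow> free_alg unital (trg f)"
      by (simp add: r Arr_in[OF f])
    show "fn (mirror_arrow unital f) 1 = 1" if unital
      using that Arr_hom[OF f] by (simp add: free_alg_closed alg_hom_def)
    fix u v :: "('x, 'k) nc_poly"
    assume u: "u \<in> free_alg unital (src f)"
    show "fn (mirror_arrow unital f) (scale a u) = scale a (fn (mirror_arrow unital f) u)" for a
      using u by (simp add: free_alg_closed reversal_scale r Arr_scale[OF f])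
    assume v: "v \<in> free_alg unital (src f)"
    show "fn (mirror_arrow unital f) (u + v)
        = fn (mirror_arrow unital f) u + fn (mirror_arrow unital f) v"
      using u v by (simp add: free_alg_closed reversal_add r Arr_add[OF f])
    show "fn (mirror_arrow unital f) (u * v)
        = fn (mirror_arrow unital f) u * fn (mirror_arrow unital f) v"
      using u v by (simp add: free_alg_closed reversal_mult r Arr_mult[OF f])
  qed
  then show ?thesis
    using Arr_obj[OF f] by (simp add: free_alg_cat_def) (simp add: mirror_arrow_def)
qed

lemma mirror_arrow_mirror_arrow:
  assumes f: "f \<in> Arr (free_alg_cat unital X0)"
  shows "mirror_arrow unital (mirror_arrow unital f) = f"
  by (rule Arr_eqI[OF mirror_arrow_Arr[OF mirror_arrow_Arr[OF f]] f])
    (simp_all add: free_alg_closed reversal_gen)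

lemma mirror_arrow_Comp:
  fixes f g :: "('x, 'k::field) arrow"
  assumes f: "f \<in> Arr (free_alg_cat unital X0)" and g: "g \<in> Arr (free_alg_cat unital X0)"
    and fg: "trg f = src g"
  shows "mirror_arrow unital (Comp (free_alg_cat unital X0) g f)
    = Comp (free_alg_cat unital X0) (mirror_arrow unital g) (mirror_arrow unital f)"
proof (rule Arr_eqI)
  show "mirror_arrow unital (Comp (free_alg_cat unital X0) g f) \<in> Arr (free_alg_cat unital X0)"
    by (rule mirror_arrow_Arr[OF Comp_Arr[OF f g fg]])
  show "Comp (free_alg_cat unital X0) (mirror_arrow unital g) (mirror_arrow unital f)
      \<in> Arr (free_alg_cat unital X0)"
    using fg by (intro Comp_Arr mirror_arrow_Arr f g) simp
  fix x assume "x \<in> src (mirror_arrow unital (Comp (free_alg_cat unital X0) g f))"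
  then have x: "(gen x :: ('x, 'k) nc_poly) \<in> free_alg unital (src f)"
    by (simp add: free_alg_closed)
  then have "reversal (fn f (gen x)) \<in> free_alg unital (src g)"
    using Arr_in[OF f x] fg by (simp add: reversal_in_free_alg)
  then show "fn (mirror_arrow unital (Comp (free_alg_cat unital X0) g f)) (gen x)
      = fn (Comp (free_alg_cat unital X0) (mirror_arrow unital g) (mirror_arrow unital f)) (gen x)"
    using x by (simp add: reversal_gen)
qed simp_all

lemma mirror_arrow_Id:
  assumes "finite X" "X \<subseteq> X0"
  shows "mirror_arrow unital (Id (free_alg_cat unital X0) X) = Id (free_alg_cat unital X0) X"
  by (rule Arr_eqI[OF mirror_arrow_Arr[OF Id_Arr[OF assms]] Id_Arr[OF assms]])
    (simp_all add: free_alg_closed reversal_gen)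

definition mirror_aut :: "bool \<Rightarrow> 'x set \<Rightarrow> ('x, 'k::field) free_alg_cat_map" where
  "mirror_aut unital X0 = (\<lambda>X\<in>Obj (free_alg_cat unital X0 :: ('x set, ('x, 'k) arrow) category). X,
     restrict (mirror_arrow unital) (Arr (free_alg_cat unital X0)))"

lemma mirror_aut_simps:
  "finite X \<Longrightarrow> X \<subseteq> X0 \<Longrightarrow> fst (mirror_aut unital X0) X = X"
  "f \<in> Arr (free_alg_cat unital X0) \<Longrightarrow> snd (mirror_aut unital X0) f = mirror_arrow unital f"
  by (simp_all add: mirror_aut_def Obj_iff)

lemma mirror_aut_in_cat_automorphisms:
  "mirror_aut unital X0
    \<in> cat_automorphisms (free_alg_cat unital X0 :: ('x set, ('x, 'k::field) arrow) category)"
proof -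
  let ?C = "free_alg_cat unital X0 :: ('x set, ('x, 'k) arrow) category"
  let ?M = "mirror_aut unital X0 :: ('x, 'k) free_alg_cat_map"
  have "is_functor ?C ?C ?M"
    unfolding is_functor_def
  proof (intro conjI ballI impI)
    fix X assume "X \<in> Obj ?C"
    then have X: "finite X" "X \<subseteq> X0"
      by (simp_all add: Obj_iff)
    show "fst ?M X \<in> Obj ?C"
      using X by (simp add: mirror_aut_simps Obj_iff)
    show "snd ?M (Id ?C X) = Id ?C (fst ?M X)"
      using X by (simp add: mirror_aut_simps Id_Arr mirror_arrow_Id)
  next
    fix f assume f: "f \<in> Arr ?C"
    show "snd ?M f \<in> Arr ?C" "Dom ?C (snd ?M f) = fst ?M (Dom ?C f)"
        "Cod ?C (snd ?M f) = fst ?M (Cod ?C f)"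
      using f Arr_obj[OF f] by (simp_all add: mirror_aut_simps mirror_arrow_Arr)
    fix g assume g: "g \<in> Arr ?C" "Cod ?C f = Dom ?C g"
    then have "trg f = src g"
      by simp
    then show "snd ?M (Comp ?C g f) = Comp ?C (snd ?M g) (snd ?M f)"
      using f g(1) by (simp only: mirror_aut_simps mirror_arrow_Comp Comp_Arr)
  qed
  moreover have "bij_betw (fst ?M) (Obj ?C) (Obj ?C)"
    by (rule bij_betwI[where g = id]) (auto simp: mirror_aut_def)
  moreover have "bij_betw (snd ?M) (Arr ?C) (Arr ?C)"
    by (rule bij_betwI[where g = "mirror_arrow unital"])
      (auto simp: mirror_aut_simps mirror_arrow_Arr mirror_arrow_mirror_arrow)
  ultimately show ?thesis
    by (simp add: cat_automorphisms_def) (simp add: mirror_aut_def)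
qed

lemma mirror_aut_in_mirror_automorphisms: "mirror_aut unital X0 \<in> mirror_automorphisms unital X0"
  using mirror_aut_in_cat_automorphisms
  by (auto simp: mirror_automorphisms_def mirror_aut_simps Obj_iff free_alg_closed reversal_gen)

lemma mirror_aut_square:
  "mirror_aut unital X0 \<otimes>\<^bsub>cat_aut_group (free_alg_cat unital X0)\<^esub> mirror_aut unital X0
    = \<one>\<^bsub>cat_aut_group (free_alg_cat unital X0 :: ('x set, ('x, 'k::field) arrow) category)\<^esub>"
  by (auto simp: cat_aut_group_def compose_def mirror_aut_simps mirror_arrow_Arr
      mirror_arrow_mirror_arrow Obj_iff intro!: restrict_ext)

section \<open>Generation by the semi-inner and mirror automorphisms\<close>

theorem theorem4p2:
  fixes X0 :: "'x set" and unital :: bool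
  assumes "infinite X0"
  shows "generate (cat_aut_group (free_alg_cat unital X0))
           (semi_inner_automorphisms unital X0 \<union> mirror_automorphisms unital X0)
       = (carrier (cat_aut_group (free_alg_cat unital X0)) :: ('x, 'k::field) free_alg_cat_map set)"
proof (rule equalityI)
  let ?C = "free_alg_cat unital X0 :: ('x set, ('x, 'k) arrow) category"
  let ?G = "cat_aut_group ?C"
  let ?S = "semi_inner_automorphisms unital X0 \<union> mirror_automorphisms unital X0 :: ('x, 'k)
      free_alg_cat_map set"
  let ?M = "mirror_aut unital X0 :: ('x, 'k) free_alg_cat_map"
  interpret G: group ?G
    by (rule group_Aut_free_alg_cat)
  have carrier: "carrier ?G = cat_automorphisms ?C"
    by (simp add: cat_aut_group_def)
  show "generate ?G ?S \<subseteq> carrier ?G"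
    by (rule G.generate_incl)
      (auto simp: carrier semi_inner_automorphisms_def mirror_automorphisms_def)
  show "carrier ?G \<subseteq> generate ?G ?S"
  proof
    fix F assume F_carrier: "F \<in> carrier ?G"
    interpret free_alg_cat_automorphism unital X0 F
      using assms F_carrier by unfold_locales (simp_all add: carrier)
    obtain s where s_bij: "\<And>X. finite X \<Longrightarrow> X \<subseteq> X0 \<Longrightarrow> bij_betw (s X) (A X) (A (\<phi> X))"
      and s_zero: "\<And>X. s X 0 = 0"
      and s_Arr: "\<And>a u. a \<in> Arr ?C \<Longrightarrow> u \<in> A (src a) \<Longrightarrow> fn (\<Phi> a) (s (src a) u) = s (trg a) (fn a u)"
      by (rule ex_equivariant_family) blast
    obtain d c where dc: "field_aut d" "c \<noteq> 0"
      and s_add: "\<And>X u v. finite X \<Longrightarrow> X \<subseteq> X0 \<Longrightarrow> u \<in> A X \<Longrightarrow> v \<in> A X \<Longrightarrow> s X (u + v) = s X u + s X v"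
      and s_scale: "\<And>X u a. finite X \<Longrightarrow> X \<subseteq> X0 \<Longrightarrow> u \<in> A X \<Longrightarrow> s X (scale a u) = scale (d a) (s X u)"
      and s_mult: "(\<forall>X u v. finite X \<longrightarrow> X \<subseteq> X0 \<longrightarrow> u \<in> A X \<longrightarrow> v \<in> A X
          \<longrightarrow> s X (u * v) = scale c (s X u * s X v)) \<or>
        (\<forall>X u v. finite X \<longrightarrow> X \<subseteq> X0 \<longrightarrow> u \<in> A X \<longrightarrow> v \<in> A X \<longrightarrow> s X (u * v) = scale c (s X v * s X u))"
      using s_ring_structure[OF s_bij s_zero s_Arr] by blast
    have s_mem: "s X u \<in> A (\<phi> X)" if "finite X" "X \<subseteq> X0" "u \<in> A X" for X u
      using bij_betwE[OF s_bij[OF that(1,2)]] that(3) by blast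
    \<comment> \<open>Rescaling absorbs the factor: \<open>s (u * v) = c s(u) s(v)\<close> makes
      \<open>c s\<close> multiplicative, and likewise with the factors exchanged.\<close>
    have cbij: "bij_betw (\<lambda>u. scale c (s X u)) (A X) (A (\<phi> X))" if "finite X" "X \<subseteq> X0" for X
      using bij_betw_trans[OF s_bij[OF that] bij_betw_scale[OF dc(2)]] by (simp add: comp_def)
    show "F \<in> generate ?G ?S"
      using s_mult
    proof
      assume mult: "\<forall>X u v. finite X \<longrightarrow> X \<subseteq> X0 \<longrightarrow> u \<in> A X \<longrightarrow> v \<in> A X
          \<longrightarrow> s X (u * v) = scale c (s X u * s X v)"
      have "semi_iso unital d (A X) (A (\<phi> X)) (\<lambda>u. scale c (s X u))" if "finite X" "X \<subseteq> X0" for X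
        using that dc cbij by (intro semi_isoI)
          (simp_all add: s_add s_scale mult scale_add_right mult.commute)
      \<comment> \<open>Equivariance is not affected by the rescaling, as \<open>\<Phi> f\<close> is
        linear.\<close>
      moreover have "fn (\<Phi> f) (scale c (s (src f) u)) = scale c (s (trg f) (fn f u))"
        if f: "f \<in> Arr ?C" and u: "u \<in> A (src f)" for f u
        using s_Arr[OF f u] Arr_scale[OF \<Phi>_Arr(1)[OF f]] s_mem[of "src f" u] Arr_obj[OF f] u
        by (simp add: \<Phi>_Arr[OF f])
      ultimately have "F \<in> semi_inner_automorphisms unital X0"
        using F_carrier unfolding semi_inner_automorphisms_def carrier
        by (intro CollectI conjI exI[of _ d] exI[of _ "\<lambda>X u. scale c (s X u)"]) (auto simp: Obj_iff)
      then show ?thesis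
        by (intro generate.incl) simp
    next
      assume mult: "\<forall>X u v. finite X \<longrightarrow> X \<subseteq> X0 \<longrightarrow> u \<in> A X \<longrightarrow> v \<in> A X
          \<longrightarrow> s X (u * v) = scale c (s X v * s X u)"
      \<comment> \<open>In the order-reversing case the mirror automorphism is split off; being an
        involution, it also recovers \<open>F\<close> from \<open>H\<close>.\<close>
      define H where "H = F \<otimes>\<^bsub>?G\<^esub> ?M"
      have M: "?M \<in> carrier ?G"
        by (simp add: carrier mirror_aut_in_cat_automorphisms)
      have "H \<otimes>\<^bsub>?G\<^esub> ?M = F \<otimes>\<^bsub>?G\<^esub> (?M \<otimes>\<^bsub>?G\<^esub> ?M)"
        unfolding H_def using F_carrier M M by (rule G.m_assoc)
      then have FH: "F = H \<otimes>\<^bsub>?G\<^esub> ?M"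
        using F_carrier by (simp only: mirror_aut_square G.r_one)
      have H: "fst H X = \<phi> X" if "finite X" "X \<subseteq> X0" for X
        using that by (simp add: H_def cat_aut_group_def compose_def Obj_iff mirror_aut_simps)
      have H': "snd H f = \<Phi> (mirror_arrow unital f)" if "f \<in> Arr ?C" for f
        using that by (simp add: H_def cat_aut_group_def compose_def mirror_aut_simps)
      \<comment> \<open>Precomposing the anti-multiplicative map with reversal restores the order of
        the factors.\<close>
      let ?s = "\<lambda>X u. scale c (s X (reversal u))"
      have "semi_iso unital d (A X) (A (fst H X)) (?s X)" if X: "finite X" "X \<subseteq> X0" for X
        unfolding H[OF X]
      proof (rule semi_isoI[OF dc(1)])
        show "bij_betw (?s X) (A X) (A (\<phi> X))"
          using bij_betw_trans[OF bij_betw_reversal cbij[OF X]] by (simp add: comp_def)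
      qed (use X in \<open>simp_all add: s_add s_scale mult scale_add_right mult.commute
          reversal_in_free_alg
            reversal_add reversal_scale reversal_mult\<close>)
      moreover have "fn (snd H f) (?s (src f) u) = ?s (trg f) (fn f u)"
        if f: "f \<in> Arr ?C" and u: "u \<in> A (src f)" for f u
      proof -
        note m = mirror_arrow_Arr[OF f]
        have ru: "reversal u \<in> A (src f)"
          using u by (rule reversal_in_free_alg)
        have "fn (snd H f) (?s (src f) u)
            = scale c (fn (\<Phi> (mirror_arrow unital f)) (s (src f) (reversal u)))"
          using Arr_scale[OF \<Phi>_Arr(1)[OF m]] s_mem[of "src f", OF _ _ ru] Arr_obj[OF f]
          by (simp add: H'[OF f] \<Phi>_Arr[OF m])
        also have "\<dots> = ?s (trg f) (fn f u)"
          using s_Arr[OF m, of "reversal u"] ru by simp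
        finally show ?thesis .
      qed
      moreover have "H \<in> cat_automorphisms ?C"
        using G.m_closed[OF F_carrier M] by (simp add: H_def carrier)
      ultimately have "H \<in> semi_inner_automorphisms unital X0"
        unfolding semi_inner_automorphisms_def
        by (intro CollectI conjI exI[of _ d] exI[of _ ?s]) (auto simp: Obj_iff)
      then have "H \<in> generate ?G ?S" "?M \<in> generate ?G ?S"
        by (auto intro: generate.incl mirror_aut_in_mirror_automorphisms)
      then show ?thesis
        by (subst FH) (rule generate.eng)
    qed
  qed
qed

end
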